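(* Let $(L^+,L^-)$ be a pair of fully transverse prelaminations of $S^1$. Given any homeomorphism $f$ of $S^1$, there exists a homeomorphism $F$ of $\mathbb D^2$ sending geodesics of $\mathrm{Geo}(L^\pm)$ to geodesics of $\mathrm{Geo}(f(L^\pm))$ and restricting to $f$ on $S^1$.
   Context: $\mathbb D^2$ is the closed unit disc in $\mathbb R^2$ with boundary $S^1$. Pairs $\{a_1,a_2\},\{b_1,b_2\}$ of distinct points of $S^1$ cross if $a_1,a_2$ lie in different components of $S^1\setminus\{b_1,b_2\}$. A prelamination is a set of unordered pairs of distinct points of $S^1$ (leaves) no two of which cross. $\mathrm{Geo}(L)$ is the set of Euclidean straight chords in $\mathbb D^2$ whose pair of endpoints is a leaf of $L$. $(L^+,L^-)$ is fully transverse if $L^+\cap L^-=\emptyset$, the set of endpoints of leaves of $L^+\cup L^-$ is dense in $S^1$, and for any $\alpha,\beta\in L^+\cup L^-$ there is a sequence $\alpha=\alpha_1,\dots,\alpha_k=\beta$ of leaves with $\alpha_i$ crossing $\alpha_{i+1}$. $f(L^\pm)=\{\{f(a),f(a')\}:\{a,a'\}\in L^\pm\}$. *)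

theory Defs
  imports "HOL-Analysis.Analysis"
begin

abbreviation circle :: "complex set" where
  "circle \<equiv> sphere 0 1"

abbreviation disc :: "complex set" where
  "disc \<equiv> cball 0 1"

definition is_pair :: "complex set \<Rightarrow> bool" where
  "is_pair l \<longleftrightarrow> (\<exists>a b. a \<in> circle \<and> b \<in> circle \<and> a \<noteq> b \<and> l = {a, b})"

definition crosses :: "complex set \<Rightarrow> complex set \<Rightarrow> bool" where
  "crosses l m \<longleftrightarrow> is_pair l \<and> is_pair m \<and>
     (\<exists>a1 a2. l = {a1, a2} \<and> a1 \<in> circle - m \<and> a2 \<in> circle - m \<and>
        \<not> connected_component (circle - m) a1 a2)"

definition prelamination :: "complex set set \<Rightarrow> bool" where
  "prelamination L \<longleftrightarrow> (\<forall>l\<in>L. is_pair l) \<and> (\<forall>l\<in>L. \<forall>m\<in>L. \<not> crosses l m)"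

definition Geo :: "complex set set \<Rightarrow> complex set set" where
  "Geo L = {closed_segment a b | a b. {a, b} \<in> L}"

definition fully_transverse :: "complex set set \<Rightarrow> complex set set \<Rightarrow> bool" where
  "fully_transverse Lp Lm \<longleftrightarrow>
     Lp \<inter> Lm = {} \<and>
     circle \<subseteq> closure (\<Union>(Lp \<union> Lm)) \<and>
     (\<forall>\<alpha>\<in>Lp \<union> Lm. \<forall>\<beta>\<in>Lp \<union> Lm.
        (\<lambda>x y. x \<in> Lp \<union> Lm \<and> y \<in> Lp \<union> Lm \<and> crosses x y)\<^sup>*\<^sup>* \<alpha> \<beta>)"

definition image_lam :: "(complex \<Rightarrow> complex) \<Rightarrow> complex set set \<Rightarrow> complex set set" where
  "image_lam f L = {{f a, f a'} | a a'. {a, a'} \<in> L}"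

end

theory Submission
  imports Defs
begin

text \<open>
  Pass to the closures of the two laminations. Transversality forces them to have no nondegenerate
  leaf in common. The set \<open>K\<close> of points that lie on a leaf of each closed lamination (with the circle
  included) then has only one possible map to the corresponding set of the image pair, continuous by
  compactness. Extend it affinely to the gaps of \<open>K\<close> on each leaf, which gives \<open>\<psi>\<close> on the union \<open>Y\<close>
  of all leaves. A component of the complement of \<open>Y\<close> is convex; choose two points \<open>u\<close>, \<open>v\<close> of its
  boundary whose midpoint lies inside, and extend by coning the boundary from that midpoint, which is
  sent to the midpoint of \<open>\<psi> u\<close> and \<open>\<psi> v\<close>. No regularity of the components is needed for continuity:
  every point is a convex combination of boundary points that no leaf separates, its image is the same
  combination of their images, and both properties pass to limits, where a limit point on a leaf forces
  all boundary points of positive weight onto a single affine piece. Injectivity holds because the map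
  respects the sides of every leaf, and surjectivity because the circle is not a retract of the disc.
\<close>

section \<open>Chords\<close>

text \<open>Only order data enter: a point is known by the signs of \<open>side\<close> with respect
  to all leaves. For a proper convex combination of two points that no leaf strictly separates,
  these signs do not depend on the weight. So the sign relation between a point and its image, known
  on the circle, passes to \<open>K\<close>, to \<open>Y\<close> and to the gaps, whatever weights
  occur in the image. The obstacle is that infinitely many gaps may accumulate on a leaf, with cone
  points chosen independently in each. A midpoint of two points of the compact set \<open>Y\<close>
  keeps the choice under control: limits of cone points are again such midpoints, and the images of
  the cone points converge to the midpoint of the images under \<open>\<psi>\<close>. An arbitrary
  inner point of each gap, sent to an arbitrary point of the image gap, would offer nothing of the
  kind.\<close>

definition side :: "complex \<Rightarrow> complex \<Rightarrow> complex \<Rightarrow> real" where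
  "side a b z = Im (cnj (b - a) * (z - a))"

definition mix :: "real \<Rightarrow> complex \<Rightarrow> complex \<Rightarrow> complex" where
  "mix t u v = (1 - t) *\<^sub>R u + t *\<^sub>R v"

lemma mix_0 [simp]: "mix 0 u v = u" and mix_1 [simp]: "mix 1 u v = v"
  and mix_same [simp]: "mix t u u = u"
  by (simp_all add: mix_def algebra_simps)

lemma mix_in_closed: "0 \<le> t \<Longrightarrow> t \<le> 1 \<Longrightarrow> mix t u v \<in> closed_segment u v"
  by (auto simp: mix_def closed_segment_def)

lemma closed_segment_mix: "z \<in> closed_segment u v \<longleftrightarrow> (\<exists>t. 0 \<le> t \<and> t \<le> 1 \<and> z = mix t u v)"
  by (auto simp: mix_def closed_segment_def)

lemma open_segment_mix:
  "z \<in> open_segment u v \<longleftrightarrow> u \<noteq> v \<and> (\<exists>t. 0 < t \<and> t < 1 \<and> z = mix t u v)"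
  by (auto simp: mix_def in_segment)

text \<open>\<open>side a b z\<close> is the cross product of \<open>b - a\<close> and
  \<open>z - a\<close>, hence affine in \<open>z\<close> and positive to the left of the chord
  directed from \<open>a\<close> to \<open>b\<close>. For \<open>a = b\<close> it vanishes
  identically, so degenerate leaves impose no sign condition.\<close>

lemma side_mix: "side a b (mix t u v) = (1 - t) * side a b u + t * side a b v"
  by (simp add: side_def mix_def algebra_simps)

lemma side_refl [simp]: "side a a z = 0" "side a b a = 0" "side a b b = 0"
  by (simp_all add: side_def algebra_simps)

lemma side_swap: "side b a z = - side a b z"
  by (simp add: side_def algebra_simps)

lemma continuous_on_side [continuous_intros]:
  assumes "continuous_on S f" "continuous_on S g" "continuous_on S h"
  shows "continuous_on S (\<lambda>x. side (f x) (g x) (h x))"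
  unfolding side_def by (intro continuous_intros assms)

lemma tendsto_side [tendsto_intros]:
  assumes "(f \<longlongrightarrow> a) F" "(g \<longlongrightarrow> b) F" "(h \<longlongrightarrow> z) F"
  shows "((\<lambda>x. side (f x) (g x) (h x)) \<longlongrightarrow> side a b z) F"
  unfolding side_def by (intro tendsto_intros assms)

lemma tendsto_mix [tendsto_intros]:
  assumes "(f \<longlongrightarrow> t) F" "(g \<longlongrightarrow> u) F" "(h \<longlongrightarrow> v) F"
  shows "((\<lambda>x. mix (f x) (g x) (h x)) \<longlongrightarrow> mix t u v) F"
  unfolding mix_def by (intro tendsto_intros assms)

text \<open>For \<open>a \<noteq> b\<close> the right-hand side is at most 1 exactly when
  \<open>t\<close> lies between 0 and 1; this turns "on the line and in the disc" into "on the
  chord".\<close>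

lemma norm_mix_circle:
  assumes "a \<in> circle" "b \<in> circle"
  shows "(norm (mix t a b))\<^sup>2 = 1 - t * (1 - t) * (norm (b - a))\<^sup>2"
proof -
  have 1: "(Re a)\<^sup>2 + (Im a)\<^sup>2 = 1" "(Re b)\<^sup>2 + (Im b)\<^sup>2 = 1"
    using assms by (simp_all add: cmod_def)
  have *: "((1 - t) * x + t * y)\<^sup>2 = (1 - t) * x\<^sup>2 + t * y\<^sup>2 - t * (1 - t) * (y - x)\<^sup>2" for x y :: real
    by (simp add: power2_eq_square algebra_simps)
  have "(1 - t) * ((Re a)\<^sup>2 + (Im a)\<^sup>2) + t * ((Re b)\<^sup>2 + (Im b)\<^sup>2) = 1"
    by (subst 1)+ simp
  then show ?thesis
    unfolding cmod_power2 mix_def minus_complex.simps plus_complex.simps scaleR_complex.simps *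
    by (simp add: distrib_left)
qed

lemma side_0_mix:
  assumes "a \<noteq> b" "side a b z = 0"
  obtains t where "z = mix t a b"
proof -
  \<comment> \<open>The cross product vanishes exactly when this quotient is real, and its real part
    is then the parameter sought.\<close>
  define w where "w = (z - a) / (b - a)"
  have "cnj (b - a) * (z - a) = w * (cnj (b - a) * (b - a))"
    using assms(1) by (simp add: w_def)
  also have "cnj (b - a) * (b - a) = of_real ((norm (b - a))\<^sup>2)"
    by (metis complex_norm_square mult.commute)
  finally have "Im w * (norm (b - a))\<^sup>2 = 0"
    using assms(2) by (simp add: side_def)
  then have "Im w = 0" using assms(1) by simp
  then have "w = of_real (Re w)" by (simp add: complex_eq_iff)
  then have "z - a = of_real (Re w) * (b - a)"
    using assms(1) unfolding w_def by (metis divide_eq_eq eq_iff_diff_eq_0)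
  then have "z = mix (Re w) a b" by (simp add: mix_def scaleR_conv_of_real algebra_simps)
  then show thesis by (rule that)
qed

lemma side_0_segment:
  assumes "a \<in> circle" "b \<in> circle" "a \<noteq> b" "z \<in> disc" "side a b z = 0"
  shows "z \<in> closed_segment a b"
proof -
  obtain t where t: "z = mix t a b" using side_0_mix assms by metis
  have "(norm z)\<^sup>2 \<le> 1" using assms(4) by (simp add: power_le_one)
  then have "t * (1 - t) \<ge> 0"
    using norm_mix_circle[OF assms(1,2), of t] assms(3)
    by (simp add: t zero_le_mult_iff mult_le_0_iff)
  then have "0 \<le> t \<and> t \<le> 1" by (auto simp: zero_le_mult_iff)
  then show ?thesis using t closed_segment_mix by blast
qed

lemma segment_side_0: "z \<in> closed_segment a b \<Longrightarrow> side a b z = 0"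
  by (auto simp: closed_segment_mix side_mix)

lemma segment_in_disc: "u \<in> disc \<Longrightarrow> v \<in> disc \<Longrightarrow> closed_segment u v \<subseteq> disc"
  by (simp add: closed_segment_subset)

lemma mix_in_disc: "u \<in> disc \<Longrightarrow> v \<in> disc \<Longrightarrow> 0 \<le> t \<Longrightarrow> t \<le> 1 \<Longrightarrow> mix t u v \<in> disc"
  using mix_in_closed segment_in_disc by blast

lemma mix_in_ball:
  assumes "u \<in> disc" "v \<in> disc" "u \<noteq> v" "0 < t" "t < 1"
  shows "norm (mix t u v) < 1"
proof -
  have "mix t u v \<in> open_segment u v" using assms by (auto simp: open_segment_mix)
  then show ?thesis
    using assms(1,2) by (metis dist_decreases_open_segment dist_0_norm dist_commute less_le_trans mem_cball max.cobounded1 max_def)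
qed

lemma mix_on_circle:
  assumes "u \<in> disc" "v \<in> disc" "0 \<le> t" "t \<le> 1" "mix t u v \<in> circle"
  shows "t = 0 \<or> t = 1 \<or> u = v"
  using mix_in_ball[of u v t] assms by fastforce

lemma inner_mix:
  assumes "y \<in> closed_segment u v" "u \<in> circle" "v \<in> circle" "norm y < 1"
  shows "\<exists>t. 0 < t \<and> t < 1 \<and> y = mix t u v"
proof -
  obtain t where t: "0 \<le> t" "t \<le> 1" "y = mix t u v" using assms(1) closed_segment_mix by metis
  then have "t \<noteq> 0" using assms(2,4) by auto
  moreover have "t \<noteq> 1" using t assms(3,4) by auto
  ultimately show ?thesis using t by (intro exI[of _ t]) simp
qed

lemma segment_circle:
  assumes "a \<in> circle" "b \<in> circle" "z \<in> closed_segment a b" "z \<in> circle"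
  shows "z = a \<or> z = b"
  using assms mix_on_circle[of a b] by (force simp: closed_segment_mix)

lemma side_0_circle:
  assumes "a \<in> circle" "b \<in> circle" "a \<noteq> b" "z \<in> circle" "side a b z = 0"
  shows "z = a \<or> z = b"
  using assms side_0_segment segment_circle by (metis sphere_cball subsetD)

lemma sgn_mix:
  fixes x y :: real
  assumes "x * y \<ge> 0" "0 < t" "t < 1"
  shows "sgn ((1 - t) * x + t * y) = (if x = 0 then sgn y else sgn x)"
proof -
  consider "x = 0" | "x > 0" "y \<ge> 0" | "x < 0" "y \<le> 0"
    using assms(1) unfolding zero_le_mult_iff by linarith
  then show ?thesis
  proof cases
    case 1 then show ?thesis using assms by (simp add: sgn_mult)
  next
    case 2 then have "(1 - t) * x + t * y > 0" using assms by (simp add: add_pos_nonneg)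
    then show ?thesis using 2 by simp
  next
    case 3 
    have "(1 - t) * x < 0" "t * y \<le> 0" using 3 assms by (simp_all add: mult_pos_neg mult_nonneg_nonpos)
    then have "(1 - t) * x + t * y < 0" by linarith
    then show ?thesis using 3 by simp
  qed
qed

text \<open>Two weights are allowed because by \<open>sgn_mix\<close> neither affects the sign; a
  point and its image may divide their chords in different ratios.\<close>

lemma sgn_mix_scaled:
  fixes x y x' y' \<sigma> :: real
  assumes "x * y \<ge> 0" "sgn x' = \<sigma> * sgn x" "sgn y' = \<sigma> * sgn y" "\<sigma> \<noteq> 0"
    and "0 < t" "t < 1" "0 < s" "s < 1"
  shows "sgn ((1 - s) * x' + s * y') = \<sigma> * sgn ((1 - t) * x + t * y)"
proof -
  have "sgn (x' * y') = \<sigma>\<^sup>2 * sgn (x * y)" by (simp add: sgn_mult assms(2,3) power2_eq_square)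
  also have "\<dots> \<ge> 0" using assms(1) by (simp add: sgn_if)
  finally have "x' * y' \<ge> 0" by (simp only: zero_le_sgn_iff)
  moreover have "x' = 0 \<longleftrightarrow> x = 0" using assms(2,4) by (metis mult_eq_0_iff sgn_0_0)
  ultimately show ?thesis by (simp add: sgn_mix assms)
qed

text \<open>Applied to sides, this pulls segments into leaves: a leaf through an inner point of a
  segment whose ends it does not separate has side zero at both ends.\<close>

lemma mix_zero:
  fixes x y :: real
  assumes "x * y \<ge> 0" "0 < t" "t < 1" "(1 - t) * x + t * y = 0"
  shows "x = 0" "y = 0"
  using sgn_mix[OF assms(1-3)] assms(2-4) by (auto split: if_splits simp: sgn_zero_iff)

lemma zero_between:
  fixes x y :: real
  assumes "x * y < 0"
  obtains t where "0 < t" "t < 1" "(1 - t) * x + t * y = 0"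
proof -
  define t where "t = x / (x - y)"
  have "x \<noteq> y" using assms by (auto simp: mult_less_0_iff)
  have "0 < t" "t < 1" using assms by (auto simp: t_def mult_less_0_iff field_simps)
  moreover have "(1 - t) * x + t * y = 0" using \<open>x \<noteq> y\<close> by (simp add: t_def field_simps)
  ultimately show thesis using that by blast
qed

lemma mix_inj: "u \<noteq> v \<Longrightarrow> mix s u v = mix t u v \<longleftrightarrow> s = t"
proof -
  assume "u \<noteq> v"
  have "mix s u v - mix t u v = (s - t) *\<^sub>R (v - u)" by (simp add: mix_def algebra_simps)
  then show ?thesis using \<open>u \<noteq> v\<close> by (metis eq_iff_diff_eq_0 scaleR_eq_0_iff)
qed

text \<open>Along the line through \<open>a\<close> and \<open>b\<close> the function
  \<open>side c d\<close> is affine. Two zeros make it vanish at \<open>a\<close> and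
  \<open>b\<close>, and a line meets the circle in at most two points.\<close>

lemma chords_meet_once:
  assumes "a \<in> circle" "b \<in> circle" "c \<in> circle" "d \<in> circle"
    and "a \<noteq> b" "c \<noteq> d" "{a, b} \<noteq> {c, d}"
    and "side a b p = 0" "side a b q = 0" "side c d p = 0" "side c d q = 0"
  shows "p = q"
proof (rule ccontr)
  assume "p \<noteq> q"
  obtain x y where xy: "p = mix x a b" "q = mix y a b" using side_0_mix assms by metis
  then have "x \<noteq> y" using \<open>p \<noteq> q\<close> by auto
  have "(1 - x) * side c d a + x * side c d b = 0" "(1 - y) * side c d a + y * side c d b = 0"
    using assms(10,11) by (simp_all add: xy side_mix)
  then have "(y - x) * (side c d b - side c d a) = 0" "side c d a + x * (side c d b - side c d a) = 0"
    by (simp_all add: algebra_simps)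
  then have "side c d a = 0" "side c d b = 0" using \<open>x \<noteq> y\<close> by auto
  then have "a = c \<or> a = d" "b = c \<or> b = d" using side_0_circle assms by metis+
  then show False using assms by auto
qed

lemma mix_swap: "mix t v u = mix (1 - t) u v"
  by (simp add: mix_def)

lemma mix_mix: "mix t (mix x a b) (mix y a b) = mix ((1 - t) * x + t * y) a b"
  by (simp add: mix_def algebra_simps)

text \<open>Away from \<open>p\<close> the two rays coincide, so the nearer of \<open>q1\<close>,
  \<open>q2\<close> lies between \<open>p\<close> and the farther one. This serves uniqueness of
  cone coordinates in a gap and, in the image, injectivity.\<close>

lemma mix_cone:
  assumes "p \<noteq> q1" "p \<noteq> q2" "0 \<le> s1" "0 \<le> s2" "mix s1 p q1 = mix s2 p q2"
  shows "s1 = 0 \<and> s2 = 0 \<or> q1 = q2 \<and> s1 = s2 \<or> q1 \<in> open_segment p q2 \<or> q2 \<in> open_segment p q1"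
proof -
  have *: "s1 *\<^sub>R (q1 - p) = s2 *\<^sub>R (q2 - p)" using assms(5) by (simp add: mix_def algebra_simps)
  have z: "s1 = 0 \<longleftrightarrow> s2 = 0" using * assms(1,2) by (metis eq_iff_diff_eq_0 scaleR_eq_0_iff)
  have key: "q \<in> open_segment p q'" if "0 < s'" "s' < s" "s *\<^sub>R (q - p) = s' *\<^sub>R (q' - p)" "p \<noteq> q'" for s s' q q'
  proof -
    have "(s' / s) *\<^sub>R (q' - p) = (1 / s) *\<^sub>R (s' *\<^sub>R (q' - p))" by simp
    also have "\<dots> = q - p" using that(1,2) by (simp flip: that(3))
    finally have "q = mix (s' / s) p q'" by (simp add: mix_def algebra_simps)
    moreover have "0 < s' / s" "s' / s < 1" using that by simp_all
    ultimately show ?thesis using that(4) open_segment_mix by blast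
  qed
  consider "s1 = 0" "s2 = 0" | "s1 = s2" "s1 > 0" | "0 < s1" "s1 < s2" | "0 < s2" "s2 < s1"
    using assms(3,4) z by linarith
  then show ?thesis
  proof cases
    case 2
    then have "q1 = q2" using * by simp
    then show ?thesis using 2 by simp
  next
    case 3 then show ?thesis using key[of s1 s2 q2 q1] * assms by simp
  next
    case 4 then show ?thesis using key[of s2 s1 q1 q2] * assms by simp
  qed simp
qed

text \<open>In parameters on the chord this concerns intervals: two of them share an inner point and
  no end of the second is interior to the first, so the second contains the first.\<close>

lemma segment_overlap:
  fixes a b :: complex
  assumes "u \<in> closed_segment a b" "v \<in> closed_segment a b" "u' \<in> closed_segment a b" "v' \<in> closed_segment a b"
    and "z \<in> open_segment u v" "z \<in> open_segment u' v'" "u' \<notin> open_segment u v" "v' \<notin> open_segment u v"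
  shows "u \<in> closed_segment u' v'" "v \<in> closed_segment u' v'"
proof -
  obtain x y x' y' where e: "u = mix x a b" "v = mix y a b" "u' = mix x' a b" "v' = mix y' a b"
    using assms(1-4) closed_segment_mix by metis
  have ab: "a \<noteq> b" using assms(5) e by auto
  have "z \<in> closed_segment a b"
    using assms(1,2,5) by (meson convex_closed_segment closed_segment_subset open_closed_segment subsetD)
  then obtain \<zeta> where z: "z = mix \<zeta> a b" using closed_segment_mix by metis
  have o: "mix r a b \<in> open_segment (mix s a b) (mix t a b) \<longleftrightarrow> r \<in> open_segment s t" for r s t
    using ab by (auto simp: open_segment_mix mix_inj mix_mix in_segment)
  have c: "mix r a b \<in> closed_segment (mix s a b) (mix t a b) \<longleftrightarrow> r \<in> closed_segment s t" for r s t
    using ab by (auto simp: closed_segment_mix mix_inj mix_mix in_segment)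
  show "u \<in> closed_segment u' v'" "v \<in> closed_segment u' v'"
    using assms(5-8) unfolding e z o c
    by (auto simp: open_segment_eq_real_ivl closed_segment_eq_real_ivl split: if_splits)
qed

lemma segment_tail:
  fixes z :: complex
  assumes "z \<in> closed_segment a b" "u \<in> closed_segment z a"
  shows "z \<in> closed_segment u b"
proof -
  have "dist a b = dist a z + dist z b" "dist z a = dist z u + dist u a"
    using assms between between_mem_segment by metis+
  moreover have "dist a b \<le> dist a u + dist u b" "dist u b \<le> dist u z + dist z b"
    by (rule dist_triangle)+
  ultimately have "dist u b = dist u z + dist z b" by (simp add: dist_commute)
  then show ?thesis using between between_mem_segment by metis
qed

text \<open>Lying on a segment is equality in the triangle inequality, a closed condition on all
  three points.\<close>

lemma segment_limit:
  fixes z :: complex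
  assumes "A \<longlonglongrightarrow> a" "B \<longlonglongrightarrow> b" "X \<longlonglongrightarrow> z" "\<And>n. X n \<in> closed_segment (A n) (B n)"
  shows "z \<in> closed_segment a b"
proof -
  have "(\<lambda>n. dist (A n) (B n)) \<longlonglongrightarrow> dist a b" by (intro tendsto_intros assms)
  moreover have "dist (A n) (B n) = dist (A n) (X n) + dist (X n) (B n)" for n
    using assms(4)[of n] between between_mem_segment by metis
  moreover have "(\<lambda>n. dist (A n) (X n) + dist (X n) (B n)) \<longlonglongrightarrow> dist a z + dist z b"
    by (intro tendsto_intros assms)
  ultimately have "dist a b = dist a z + dist z b" using LIMSEQ_unique by simp
  then show ?thesis using between between_mem_segment by metis
qed

text \<open>A closed graph over a compact target reduces continuity to sequences whose images
  already converge; only the limit has to be identified. All three continuity proofs below have this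
  shape.\<close>

lemma continuous_on_sequential_graph:
  fixes h :: "'a::euclidean_space \<Rightarrow> 'b::euclidean_space"
  assumes "closed S" "compact T" "\<And>z. z \<in> S \<Longrightarrow> h z \<in> T"
    and lim: "\<And>X z w. \<lbrakk>\<And>n. X n \<in> S; X \<longlonglongrightarrow> z; z \<in> S; (\<lambda>n. h (X n)) \<longlonglongrightarrow> w\<rbrakk> \<Longrightarrow> h z = w"
  shows "continuous_on S h"
proof (rule continuous_from_closed_graph[OF assms(2)])
  show "h \<in> S \<rightarrow> T" using assms(3) by blast
  show "closed ((\<lambda>x. (x, h x)) ` S)"
    unfolding closed_sequential_limits
  proof (intro allI impI, elim conjE)
    fix P l assume P: "\<forall>n. P n \<in> (\<lambda>x. (x, h x)) ` S" "P \<longlonglongrightarrow> l"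
    have "fst (P n) \<in> S \<and> snd (P n) = h (fst (P n))" for n
      using P(1) by (metis (no_types, lifting) fst_conv imageE snd_conv)
    then have "\<And>n. fst (P n) \<in> S" "\<And>n. snd (P n) = h (fst (P n))" by blast+
    moreover have "(\<lambda>n. fst (P n)) \<longlonglongrightarrow> fst l" "(\<lambda>n. snd (P n)) \<longlonglongrightarrow> snd l"
      by (intro tendsto_intros P)+
    moreover have "fst l \<in> S" by (rule closed_sequentially[OF assms(1)]) (use calculation in auto)
    ultimately have "h (fst l) = snd l" using lim[of "\<lambda>n. fst (P n)"] by simp
    then have "l = (fst l, h (fst l))" by (simp add: prod_eq_iff)
    then show "l \<in> (\<lambda>x. (x, h x)) ` S" using \<open>fst l \<in> S\<close> by (rule image_eqI)
  qed
qed

lemma mix_norm_lt: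
  assumes "norm u < 1" "v \<in> disc" "0 \<le> s" "s < 1"
  shows "norm (mix s u v) < 1"
  using mix_in_ball[of u v s] assms by (cases "u = v \<or> s = 0") auto

section \<open>Extension over the disc\<close>

text \<open>
  Leaves are ordered pairs here, and the degenerate leaves \<open>(a, a)\<close> put the whole circle into \<open>K\<close>.
  The sign \<open>\<sigma> a b\<close> records whether \<open>f\<close> preserves or reverses the orientation; allowing it to depend
  on the leaf makes it unnecessary to show that it does not.
\<close>
locale closed_bilamination =
  fixes \<Gamma> :: "bool \<Rightarrow> (complex \<times> complex) set"
    and f :: "complex \<Rightarrow> complex" and \<sigma> :: "complex \<Rightarrow> complex \<Rightarrow> real"
  assumes closed_leaves: "closed (\<Gamma> i)"
    and leaf_circle: "(a, b) \<in> \<Gamma> i \<Longrightarrow> a \<in> circle \<and> b \<in> circle"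
    and diagonal: "a \<in> circle \<Longrightarrow> (a, a) \<in> \<Gamma> i"
    and uncrossed: "(a, b) \<in> \<Gamma> i \<Longrightarrow> (c, d) \<in> \<Gamma> i \<Longrightarrow> side a b c * side a b d \<ge> 0"
    and no_common_leaf: "(a, b) \<in> \<Gamma> i \<Longrightarrow> (c, d) \<in> \<Gamma> j \<Longrightarrow> i \<noteq> j \<Longrightarrow> a \<noteq> b \<Longrightarrow> {a, b} \<noteq> {c, d}"
    and continuous_f: "continuous_on circle f"
    and inj_f: "inj_on f circle"
    and f_image: "f ` circle = circle"
    and \<sigma>_nonzero: "\<sigma> a b \<noteq> 0"
    and side_f: "a \<in> circle \<Longrightarrow> b \<in> circle \<Longrightarrow> x \<in> circle \<Longrightarrow>
      sgn (side (f a) (f b) (f x)) = \<sigma> a b * sgn (side a b x)"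
begin

section \<open>Leaves, the sets \<open>K\<close> and \<open>Y\<close>, and three sign
  relations\<close>

definition on_leaf :: "bool \<Rightarrow> complex \<Rightarrow> bool" where
  "on_leaf i z \<longleftrightarrow> (\<exists>a b. (a, b) \<in> \<Gamma> i \<and> z \<in> closed_segment a b)"

definition K :: "complex set" where "K = {z. on_leaf True z \<and> on_leaf False z}"

definition Y :: "complex set" where "Y = {z. \<exists>i. on_leaf i z}"

text \<open>Leaves may pass through either point. Allowing zero makes the relation closed, at the
  price of transitivity.\<close>

definition unsep :: "complex \<Rightarrow> complex \<Rightarrow> bool" where
  "unsep u v \<longleftrightarrow> (\<forall>i a b. (a, b) \<in> \<Gamma> i \<longrightarrow> side a b u * side a b v \<ge> 0)"

text \<open>Unlike \<open>unsep\<close> this is an equivalence relation. In the complement of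
  \<open>Y\<close> the two agree, and the classes there are the gaps.\<close>

definition same_sides :: "complex \<Rightarrow> complex \<Rightarrow> bool" where
  "same_sides u v \<longleftrightarrow> (\<forall>i a b. (a, b) \<in> \<Gamma> i \<longrightarrow> sgn (side a b u) = sgn (side a b v))"

text \<open>A nondegenerate leaf through \<open>z\<close> forces \<open>w\<close> onto the line of
  the image chord, so for \<open>z\<close> in \<open>K\<close> inside the disc the condition
  determines \<open>w\<close>.\<close>

definition compat :: "complex \<Rightarrow> complex \<Rightarrow> bool" where
  "compat z w \<longleftrightarrow> (\<forall>i a b. (a, b) \<in> \<Gamma> i \<longrightarrow> sgn (side (f a) (f b) w) = \<sigma> a b * sgn (side a b z))"

lemma f_circle: "a \<in> circle \<Longrightarrow> f a \<in> circle"
  using f_image by blast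

lemma compact_leaves: "compact (\<Gamma> i)"
proof -
  have "\<Gamma> i \<subseteq> circle \<times> circle" using leaf_circle by auto
  then have "bounded (\<Gamma> i)"
    using bounded_subset[OF bounded_Times[OF bounded_sphere bounded_sphere]] by blast
  then show ?thesis using closed_leaves by (metis compact_eq_bounded_closed)
qed

lemma compact_on_leaf: "compact {z. on_leaf i z}"
proof -
  have "compact ({0..1::real} \<times> \<Gamma> i)" by (intro compact_Times compact_leaves) simp
  moreover have "continuous_on ({0..1::real} \<times> \<Gamma> i) (\<lambda>p. mix (fst p) (fst (snd p)) (snd (snd p)))"
    unfolding mix_def by (intro continuous_intros)
  ultimately have "compact ((\<lambda>p. mix (fst p) (fst (snd p)) (snd (snd p))) ` ({0..1} \<times> \<Gamma> i))"
    by (rule compact_continuous_image[rotated])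
  also have "(\<lambda>p. mix (fst p) (fst (snd p)) (snd (snd p))) ` ({0..1} \<times> \<Gamma> i) = {z. on_leaf i z}"
    by (force simp: on_leaf_def closed_segment_mix image_iff)
  finally show ?thesis .
qed

lemma compact_K: "compact K" and compact_Y: "compact Y"
proof -
  have K: "K = {z. on_leaf True z} \<inter> {z. on_leaf False z}" by (auto simp: K_def)
  have Y: "Y = {z. on_leaf True z} \<union> {z. on_leaf False z}"
    unfolding Y_def by (auto simp: ex_bool_eq)
  show "compact K" "compact Y" unfolding K Y by (intro compact_Int compact_Un compact_on_leaf)+
qed

lemma K_on_leaf: "z \<in> K \<Longrightarrow> on_leaf i z"
  by (cases i) (auto simp: K_def)

lemma circle_K: "circle \<subseteq> K"
  unfolding K_def on_leaf_def using diagonal by fastforce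

lemma K_Y: "K \<subseteq> Y"
  by (auto simp: K_def Y_def)

lemma Y_disc: "Y \<subseteq> disc"
proof
  fix z assume "z \<in> Y"
  then obtain i a b where "(a, b) \<in> \<Gamma> i" "z \<in> closed_segment a b" by (auto simp: Y_def on_leaf_def)
  then show "z \<in> disc" using leaf_circle segment_in_disc by (metis sphere_cball subsetD)
qed

lemma leaf_Y: "(a, b) \<in> \<Gamma> i \<Longrightarrow> z \<in> closed_segment a b \<Longrightarrow> z \<in> Y"
  by (auto simp: Y_def on_leaf_def)

lemma leaf_disc: "(a, b) \<in> \<Gamma> i \<Longrightarrow> z \<in> closed_segment a b \<Longrightarrow> z \<in> disc"
  using leaf_Y Y_disc by blast

lemma leaf_side_Y: "(a, b) \<in> \<Gamma> i \<Longrightarrow> a \<noteq> b \<Longrightarrow> z \<in> disc \<Longrightarrow> side a b z = 0 \<Longrightarrow> z \<in> Y"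
  using leaf_Y leaf_circle side_0_segment by metis

lemma leaf_nondegenerate:
  "(a, b) \<in> \<Gamma> i \<Longrightarrow> z \<in> closed_segment a b \<Longrightarrow> norm z < 1 \<Longrightarrow> a \<noteq> b"
  using leaf_circle by fastforce

lemma on_leaf_ballE:
  assumes "on_leaf i z" "norm z < 1"
  obtains a b where "(a, b) \<in> \<Gamma> i" "z \<in> closed_segment a b" "a \<noteq> b" "a \<in> circle" "b \<in> circle"
  using assms leaf_circle leaf_nondegenerate unfolding on_leaf_def by metis

lemma Y_ballE:
  assumes "z \<in> Y" "norm z < 1"
  obtains i a b where "(a, b) \<in> \<Gamma> i" "z \<in> closed_segment a b" "a \<noteq> b" "a \<in> circle" "b \<in> circle"
  using assms on_leaf_ballE unfolding Y_def by blast

section \<open>Separation by leaves and convex combinations\<close>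

lemma unsep_sym: "unsep u v \<Longrightarrow> unsep v u"
  by (simp add: unsep_def mult.commute)

lemma unsep_refl: "unsep u u"
  by (simp add: unsep_def)

lemma same_sides_unsep: "same_sides u v \<Longrightarrow> unsep u v"
  unfolding same_sides_def unsep_def
  by (metis linorder_not_less mult_less_0_iff order_less_irrefl sgn_greater sgn_less order.asym)

lemma compat_same_sides: "compat u w \<Longrightarrow> compat v w \<Longrightarrow> same_sides u v"
  unfolding compat_def same_sides_def using \<sigma>_nonzero by (metis mult_left_cancel)

lemma compat_circle: "z \<in> circle \<Longrightarrow> compat z (f z)"
  unfolding compat_def using side_f leaf_circle by metis

lemma compat_mix:
  assumes "compat u u'" "compat v v'" "unsep u v" "0 < t" "t < 1" "0 < s" "s < 1"
  shows "compat (mix t u v) (mix s u' v')"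
  unfolding compat_def
proof (intro allI impI)
  fix i a b assume ab: "(a, b) \<in> \<Gamma> i"
  then show "sgn (side (f a) (f b) (mix s u' v')) = \<sigma> a b * sgn (side a b (mix t u v))"
    using assms \<sigma>_nonzero unfolding side_mix compat_def unsep_def by (intro sgn_mix_scaled) blast+
qed

lemma unsep_mix_leaf:
  assumes "unsep p q" "0 < t" "t < 1" "(a, b) \<in> \<Gamma> i" "side a b (mix t p q) = 0"
  shows "side a b p = 0" "side a b q = 0"
  using mix_zero[of "side a b p" "side a b q" t] assms unfolding unsep_def side_mix by blast+

lemma not_unsepE:
  assumes "\<not> unsep p q" "p \<in> disc" "q \<in> disc"
  obtains i c d k where "(c, d) \<in> \<Gamma> i" "side c d p * side c d q < 0" "k \<in> open_segment p q" "k \<in> closed_segment c d"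
proof -
  obtain i c d where cd: "(c, d) \<in> \<Gamma> i" "side c d p * side c d q < 0"
    using assms(1) unfolding unsep_def by (meson linorder_not_le)
  then obtain t where t: "0 < t" "t < 1" "side c d (mix t p q) = 0"
    using zero_between[of "side c d p" "side c d q"] by (metis side_mix)
  have "p \<noteq> q" "c \<noteq> d" using cd(2) by (auto simp: mult_less_0_iff)
  then have "mix t p q \<in> open_segment p q" using t open_segment_mix by blast
  moreover have "mix t p q \<in> disc" using assms t mix_in_disc by simp
  then have "mix t p q \<in> closed_segment c d"
    using side_0_segment leaf_circle cd(1) t(3) \<open>c \<noteq> d\<close> by metis
  ultimately show thesis using that cd by blast
qed

lemma unsep_avoid_Y:
  assumes "p \<in> disc" "q \<in> disc" "open_segment p q \<inter> Y = {}"
  shows "unsep p q"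
  using not_unsepE[OF _ assms(1,2)] assms(3) leaf_Y by (metis disjoint_iff)

text \<open>A leaf strictly separating \<open>p\<close> and \<open>q\<close> meets the segment
  between them. In the same lamination this contradicts \<open>uncrossed\<close>; in the other one
  the meeting point belongs to \<open>K\<close>.\<close>

lemma unsep_avoid_K:
  assumes ab: "(a, b) \<in> \<Gamma> i" and pq: "p \<in> closed_segment a b" "q \<in> closed_segment a b"
    and av: "open_segment p q \<inter> K = {}"
  shows "unsep p q"
proof (rule ccontr)
  assume *: "\<not> unsep p q"
  have "p \<in> disc" "q \<in> disc" using leaf_disc[OF ab] pq by blast+
  with * obtain j c d k where cd: "(c, d) \<in> \<Gamma> j" "side c d p * side c d q < 0"
    and k: "k \<in> open_segment p q" "k \<in> closed_segment c d" by (rule not_unsepE)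
  show False
  proof (cases "i = j")
    case True
    then have *: "side c d a * side c d b \<ge> 0" using uncrossed ab cd(1) by blast
    obtain x y where "0 \<le> x" "x \<le> 1" "p = mix x a b" "0 \<le> y" "y \<le> 1" "q = mix y a b"
      using pq closed_segment_mix by metis
    then have "side c d p * side c d q \<ge> 0"
      using * unfolding zero_le_mult_iff by (auto simp: side_mix add_nonneg_nonneg add_nonpos_nonpos mult_nonneg_nonpos)
    then show False using cd(2) by linarith
  next
    case False
    have "k \<in> closed_segment a b"
      using k(1) pq by (meson convex_closed_segment closed_segment_subset open_closed_segment subsetD)
    then have "on_leaf i k" "on_leaf j k" using ab cd(1) k(2) unfolding on_leaf_def by blast+
    then have "k \<in> K" using False unfolding K_def by (cases i; cases j) auto
    then show False using av k(1) by blast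
  qed
qed

text \<open>Otherwise the leaf of the other lamination through \<open>k\<close> contains
  \<open>p\<close> and \<open>q\<close>, shares two points with the leaf \<open>(a, b)\<close> and
  is the same chord. With \<open>unsep_avoid_K\<close>: points of one leaf are unseparated exactly
  when no point of \<open>K\<close> lies strictly between them.\<close>

lemma K_separates:
  assumes ab: "(a, b) \<in> \<Gamma> i" and pq: "p \<in> closed_segment a b" "q \<in> closed_segment a b"
    and k: "k \<in> open_segment p q" "k \<in> K"
  shows "\<not> unsep p q"
proof
  assume un: "unsep p q"
  have pqd: "p \<in> disc" "q \<in> disc" using leaf_disc[OF ab] pq by blast+
  obtain t where t: "0 < t" "t < 1" "k = mix t p q" and "p \<noteq> q" using k(1) open_segment_mix by metis
  have k1: "norm k < 1" using mix_in_ball pqd t \<open>p \<noteq> q\<close> by blast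
  obtain j where "j \<noteq> i" by (metis(full_types))
  obtain c d where cd: "(c, d) \<in> \<Gamma> j" "k \<in> closed_segment c d" "c \<noteq> d" "c \<in> circle" "d \<in> circle"
    using on_leaf_ballE[OF K_on_leaf[OF k(2)] k1] by metis
  have "a \<noteq> b" using pq \<open>p \<noteq> q\<close> by auto
  have "side c d p = 0" "side c d q = 0"
    using unsep_mix_leaf[OF un t(1,2) cd(1)] segment_side_0[OF cd(2)] t(3) by auto
  moreover have "side a b p = 0" "side a b q = 0" using pq segment_side_0 by blast+
  moreover have "{a, b} \<noteq> {c, d}" using no_common_leaf[OF ab cd(1)] \<open>a \<noteq> b\<close> \<open>j \<noteq> i\<close> by metis
  ultimately show False
    using chords_meet_once[of a b c d p q] leaf_circle[OF ab] cd \<open>a \<noteq> b\<close> \<open>p \<noteq> q\<close> by blast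
qed

text \<open>Two distinct chords meet at \<open>p\<close>, one from each lamination, and
  \<open>q\<close> has side zero for both.\<close>

lemma same_sides_K:
  assumes "same_sides p q" "p \<in> K" "norm p < 1"
  shows "p = q"
proof -
  obtain a b where ab: "(a, b) \<in> \<Gamma> True" "p \<in> closed_segment a b" "a \<noteq> b" "a \<in> circle" "b \<in> circle"
    using on_leaf_ballE[OF K_on_leaf[OF assms(2)] assms(3)] by metis
  obtain c d where cd: "(c, d) \<in> \<Gamma> False" "p \<in> closed_segment c d" "c \<noteq> d" "c \<in> circle" "d \<in> circle"
    using on_leaf_ballE[OF K_on_leaf[OF assms(2)] assms(3)] by metis
  have p: "side a b p = 0" "side c d p = 0" using ab cd segment_side_0 by blast+
  then have "side a b q = 0" "side c d q = 0"
    using assms(1) ab(1) cd(1) unfolding same_sides_def by (metis sgn_0_0)+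
  then show ?thesis
    using chords_meet_once[of a b c d p q] p ab cd no_common_leaf[OF ab(1) cd(1)] by blast
qed

lemma unsep_limit:
  assumes "X \<longlonglongrightarrow> u" "X' \<longlonglongrightarrow> v" "\<And>n. unsep (X n) (X' n)"
  shows "unsep u v"
  unfolding unsep_def
proof (intro allI impI)
  fix i a b assume "(a, b) \<in> \<Gamma> i"
  then have "\<forall>n. 0 \<le> side a b (X n) * side a b (X' n)" using assms(3) by (auto simp: unsep_def)
  moreover have "(\<lambda>n. side a b (X n) * side a b (X' n)) \<longlonglongrightarrow> side a b u * side a b v"
    by (intro tendsto_intros assms)
  ultimately show "0 \<le> side a b u * side a b v" by (meson LIMSEQ_le_const)
qed

section \<open>The map on \<open>K\<close>\<close>

lemma f_neq: "a \<in> circle \<Longrightarrow> b \<in> circle \<Longrightarrow> a \<noteq> b \<Longrightarrow> f a \<noteq> f b"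
  using inj_f by (auto dest: inj_onD)

text \<open>The image is where the image chords of the two leaves through \<open>z\<close> meet. For
  the signs, each leaf is compared with the leaf through \<open>z\<close> of its own lamination,
  whose ends it does not separate; hence \<open>z\<close> and \<open>w\<close> are written as
  combinations in two ways.\<close>

lemma ex_compat_crossing:
  assumes "z \<in> K" "norm z < 1"
  shows "\<exists>w. norm w < 1 \<and> compat z w"
proof -
  obtain a b where ab: "(a, b) \<in> \<Gamma> True" "z \<in> closed_segment a b" "a \<noteq> b" "a \<in> circle" "b \<in> circle"
    using on_leaf_ballE[OF K_on_leaf[OF assms(1)] assms(2)] by metis
  obtain c d where cd: "(c, d) \<in> \<Gamma> False" "z \<in> closed_segment c d" "c \<noteq> d" "c \<in> circle" "d \<in> circle"
    using on_leaf_ballE[OF K_on_leaf[OF assms(1)] assms(2)] by metis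
  obtain t where t: "0 < t" "t < 1" "z = mix t a b" using inner_mix[OF ab(2,4,5) assms(2)] by metis
  obtain t' where t': "0 < t'" "t' < 1" "z = mix t' c d" using inner_mix[OF cd(2,4,5) assms(2)] by metis
  \<comment> \<open>Otherwise \<open>c\<close> and \<open>d\<close> both lie on the line of
    \<open>a\<close> and \<open>b\<close>, which gives a leaf common to both laminations.\<close>
  have "side a b c * side a b d < 0"
  proof (rule ccontr)
    assume "\<not> side a b c * side a b d < 0"
    then have "side a b c = 0" "side a b d = 0"
      using mix_zero[of "side a b c" "side a b d" t'] t' segment_side_0[OF ab(2)] by (simp_all add: side_mix)
    then have "c = a \<or> c = b" "d = a \<or> d = b" using side_0_circle[OF ab(4,5,3)] cd by blast+
    then have "{a, b} = {c, d}" using cd(3) by blast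
    then show False using no_common_leaf[OF ab(1) cd(1) _ ab(3)] by simp
  qed
  \<comment> \<open>The factor \<open>\<sigma> a b\<close> enters squared, so a reversal of
    orientation cancels.\<close>
  moreover have "sgn (side (f a) (f b) (f c) * side (f a) (f b) (f d)) = (\<sigma> a b)\<^sup>2 * sgn (side a b c * side a b d)"
    using side_f ab cd by (simp add: sgn_mult power2_eq_square)
  ultimately have "side (f a) (f b) (f c) * side (f a) (f b) (f d) < 0"
    using \<sigma>_nonzero[of a b] mult_pos_neg[of "(\<sigma> a b)\<^sup>2" "sgn (side a b c * side a b d)"]
    by (metis sgn_less zero_less_power2)
  then obtain s' where s': "0 < s'" "s' < 1" "side (f a) (f b) (mix s' (f c) (f d)) = 0"
    using zero_between[of "side (f a) (f b) (f c)" "side (f a) (f b) (f d)"] unfolding side_mix by metis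
  define w where "w = mix s' (f c) (f d)"
  have fc: "f a \<in> circle" "f b \<in> circle" "f c \<in> circle" "f d \<in> circle" using ab cd f_circle by auto
  have w1: "norm w < 1" unfolding w_def
    by (rule mix_in_ball) (use fc s' f_neq cd in auto)
  have "w \<in> closed_segment (f a) (f b)"
    using side_0_segment[of "f a" "f b" w] fc f_neq ab s'(3) w1 w_def by simp
  then obtain s where s: "0 < s" "s < 1" "w = mix s (f a) (f b)" using inner_mix[of w] fc w1 by metis
  have "compat z w"
    unfolding compat_def
  proof (intro allI impI)
    fix i p q assume pq: "(p, q) \<in> \<Gamma> i"
    have c: "p \<in> circle" "q \<in> circle" using leaf_circle[OF pq] by auto
    show "sgn (side (f p) (f q) w) = \<sigma> p q * sgn (side p q z)"
    proof (cases i)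
      case True
      have "side p q a * side p q b \<ge> 0" using uncrossed[OF _ ab(1)] pq True by simp
      then show ?thesis unfolding t s side_mix
        using side_f[OF c ab(4)] side_f[OF c ab(5)] \<sigma>_nonzero t(1,2) s(1,2) by (intro sgn_mix_scaled)
    next
      case False
      have "side p q c * side p q d \<ge> 0" using uncrossed[OF _ cd(1)] pq False by simp
      then show ?thesis unfolding t' w_def side_mix
        using side_f[OF c cd(4)] side_f[OF c cd(5)] \<sigma>_nonzero t'(1,2) s'(1,2) by (intro sgn_mix_scaled)
    qed
  qed
  then show ?thesis using w1 by blast
qed

text \<open>On the circle \<open>compat\<close> may say too little, as a point may lie on degenerate
  leaves only, so \<open>f\<close> is prescribed there. At inner points of \<open>K\<close> the
  choice is merely formal: the value must lie on two image chords that meet once.\<close>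

definition \<phi> :: "complex \<Rightarrow> complex" where
  "\<phi> z = (if z \<in> circle then f z else SOME w. norm w < 1 \<and> compat z w)"

lemma \<phi>_circle: "z \<in> circle \<Longrightarrow> \<phi> z = f z"
  by (simp add: \<phi>_def)

lemma \<phi>_interior: "z \<in> K \<Longrightarrow> norm z < 1 \<Longrightarrow> norm (\<phi> z) < 1"
  and \<phi>_compat: "z \<in> K \<Longrightarrow> compat z (\<phi> z)"
proof -
  have *: "norm (\<phi> z) < 1 \<and> compat z (\<phi> z)" if "z \<in> K" "norm z < 1" for z
    using someI_ex[OF ex_compat_crossing[OF that]] that by (simp add: \<phi>_def)
  then show "z \<in> K \<Longrightarrow> norm z < 1 \<Longrightarrow> norm (\<phi> z) < 1" by blast
  show "compat z (\<phi> z)" if "z \<in> K"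
  proof (cases "z \<in> circle")
    case True then show ?thesis using compat_circle \<phi>_circle by simp
  next
    case False
    moreover have "norm z \<le> 1" using that K_Y Y_disc by auto
    ultimately show ?thesis using * that by simp
  qed
qed

lemma disc_cases:
  assumes "z \<in> disc" obtains "z \<in> circle" | "norm z < 1"
  using assms by fastforce

lemma K_disc: "K \<subseteq> disc"
  using K_Y Y_disc by blast

lemma \<phi>_disc: "z \<in> K \<Longrightarrow> \<phi> z \<in> disc"
  using K_disc disc_cases[of z] \<phi>_interior f_circle \<phi>_circle
  by (metis less_imp_le mem_cball_0 sphere_cball subsetD)

lemma \<phi>_inj: "inj_on \<phi> K"
proof (rule inj_onI)
  fix p q assume pq: "p \<in> K" "q \<in> K" "\<phi> p = \<phi> q"
  then have ss: "same_sides p q" "same_sides q p"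
    using compat_same_sides \<phi>_compat by metis+
  have "p \<in> disc" "q \<in> disc" using pq K_disc by blast+
  then consider "norm p < 1" | "norm q < 1" | "p \<in> circle" "q \<in> circle" using disc_cases by metis
  then show "p = q"
  proof cases
    case 3 then show ?thesis using pq(3) \<phi>_circle inj_f by (metis inj_onD)
  qed (use same_sides_K ss pq in blast)+
qed

text \<open>For a degenerate leaf all sides are zero and \<open>compat\<close> is silent; the last
  hypothesis supplies the image.\<close>

lemma compat_leaf:
  assumes "(a, b) \<in> \<Gamma> i" "z \<in> closed_segment a b" "compat z w" "w \<in> disc" "z \<in> circle \<Longrightarrow> w = f z"
  shows "w \<in> closed_segment (f a) (f b)"
proof (cases "a = b")
  case True then show ?thesis using assms(2,5) leaf_circle[OF assms(1)] by auto
next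
  case False
  have "side (f a) (f b) w = 0"
    using assms(1,3) segment_side_0[OF assms(2)] unfolding compat_def by (metis mult_zero_right sgn_0_0)
  then show ?thesis using side_0_segment f_circle f_neq False leaf_circle[OF assms(1)] assms(4) by blast
qed

text \<open>By compactness the leaves through \<open>X n\<close> subconverge to a leaf through
  \<open>z\<close>, and the image chords follow because \<open>f\<close> is continuous.\<close>

lemma leaf_limit:
  assumes "X \<longlonglongrightarrow> z" "W \<longlonglongrightarrow> w"
    and "\<And>n. \<exists>a b. (a, b) \<in> \<Gamma> i \<and> X n \<in> closed_segment a b \<and> W n \<in> closed_segment (f a) (f b)"
  shows "\<exists>a b. (a, b) \<in> \<Gamma> i \<and> z \<in> closed_segment a b \<and> w \<in> closed_segment (f a) (f b)"
proof -
  obtain A B where AB: "\<And>n. (A n, B n) \<in> \<Gamma> i" "\<And>n. X n \<in> closed_segment (A n) (B n)"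
    "\<And>n. W n \<in> closed_segment (f (A n)) (f (B n))" using assms(3) by metis
  obtain l r where l: "l \<in> \<Gamma> i" and r: "strict_mono r" "((\<lambda>n. (A n, B n)) \<circ> r) \<longlonglongrightarrow> l"
    using AB(1) compact_leaves[of i] unfolding compact_def by meson
  obtain a b where ab: "l = (a, b)" by fastforce
  have A: "(\<lambda>n. A (r n)) \<longlonglongrightarrow> a" "(\<lambda>n. B (r n)) \<longlonglongrightarrow> b"
    using tendsto_fst[OF r(2)] tendsto_snd[OF r(2)] by (simp_all add: ab o_def)
  have c: "a \<in> circle" "b \<in> circle" "\<And>n. A n \<in> circle" "\<And>n. B n \<in> circle"
    using leaf_circle l AB(1) unfolding ab by blast+
  have fA: "(\<lambda>n. f (A (r n))) \<longlonglongrightarrow> f a" "(\<lambda>n. f (B (r n))) \<longlonglongrightarrow> f b"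
    using continuous_on_tendsto_compose[OF continuous_f A(1) c(1)] continuous_on_tendsto_compose[OF continuous_f A(2) c(2)] c
    by simp_all
  have "(\<lambda>n. X (r n)) \<longlonglongrightarrow> z" "(\<lambda>n. W (r n)) \<longlonglongrightarrow> w"
    using LIMSEQ_subseq_LIMSEQ[OF assms(1) r(1)] LIMSEQ_subseq_LIMSEQ[OF assms(2) r(1)] by (simp_all add: o_def)
  then have "z \<in> closed_segment a b" "w \<in> closed_segment (f a) (f b)"
    using segment_limit[OF A] segment_limit[OF fA] AB by blast+
  then show ?thesis using l ab by blast
qed

text \<open>A limit of images lies on the image of one leaf through \<open>z\<close> from each
  lamination, and so does \<open>\<phi> z\<close>. These two chords meet only once, or one of them
  is a single point.\<close>

lemma \<phi>_continuous: "continuous_on K \<phi>"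
proof (rule continuous_on_sequential_graph)
  show "closed K" using compact_K compact_imp_closed by blast
  show "compact disc" by simp
  show "\<And>z. z \<in> K \<Longrightarrow> \<phi> z \<in> disc" by (rule \<phi>_disc)
  fix X z w assume X: "\<And>n. X n \<in> K" "X \<longlonglongrightarrow> z" "z \<in> K" "(\<lambda>n. \<phi> (X n)) \<longlonglongrightarrow> w"
  have \<phi>_leaf: "\<phi> y \<in> closed_segment (f a) (f b)" if "y \<in> K" "(a, b) \<in> \<Gamma> i" "y \<in> closed_segment a b" for y a b i
    using compat_leaf[OF that(2,3)] \<phi>_compat \<phi>_disc \<phi>_circle that(1) by blast
  have "\<exists>a b. (a, b) \<in> \<Gamma> i \<and> z \<in> closed_segment a b \<and> w \<in> closed_segment (f a) (f b)" for i
    using X(1) K_on_leaf \<phi>_leaf unfolding on_leaf_def by (intro leaf_limit[OF X(2,4)]) meson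
  then obtain a b c d where ab: "(a, b) \<in> \<Gamma> True" "z \<in> closed_segment a b" "w \<in> closed_segment (f a) (f b)"
    and cd: "(c, d) \<in> \<Gamma> False" "z \<in> closed_segment c d" "w \<in> closed_segment (f c) (f d)"
    by meson
  have \<phi>z: "\<phi> z \<in> closed_segment (f a) (f b)" "\<phi> z \<in> closed_segment (f c) (f d)"
    using \<phi>_leaf X(3) ab cd by blast+
  have c: "a \<in> circle" "b \<in> circle" "c \<in> circle" "d \<in> circle" using leaf_circle ab(1) cd(1) by blast+
  consider "a = b" | "c = d" | "a \<noteq> b" "c \<noteq> d" by blast
  then show "\<phi> z = w"
  proof cases
    case 3
    have "{a, b} \<noteq> {c, d}" using no_common_leaf[OF ab(1) cd(1)] 3 by simp
    then have "{f a, f b} \<noteq> {f c, f d}" using c f_neq by (metis doubleton_eq_iff)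
    then show ?thesis
      using chords_meet_once[of "f a" "f b" "f c" "f d"] c f_circle f_neq 3 \<phi>z ab(3) cd(3) segment_side_0
      by meson
  qed (use \<phi>z ab cd in auto)
qed

section \<open>The affine extension along leaves\<close>

text \<open>For \<open>z\<close> on a leaf but not in \<open>K\<close>, this forces \<open>u\<close> and \<open>v\<close> to be the ends of the gap of \<open>K\<close>
  around \<open>z\<close> on that leaf. Unlike that description it is a closed condition.\<close>
definition krep :: "complex \<Rightarrow> complex \<Rightarrow> complex \<Rightarrow> real \<Rightarrow> bool" where
  "krep z u v t \<longleftrightarrow> u \<in> K \<and> v \<in> K \<and> unsep u v \<and> 0 \<le> t \<and> t \<le> 1 \<and> z = mix t u v"

text \<open>A proper combination pulls \<open>u\<close> and \<open>v\<close> into every leaf through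
  \<open>z\<close>; then \<open>K_separates\<close> keeps \<open>z\<close> out of
  \<open>K\<close>.\<close>

lemma krep_cases:
  assumes "z \<in> Y" "krep z u v t"
  obtains (K) "z \<in> K" "mix t (\<phi> u) (\<phi> v) = \<phi> z"
  | (gap) "z \<notin> K" "norm z < 1" "0 < t" "t < 1" "u \<noteq> v" "z \<in> open_segment u v"
      "\<And>i a b. (a, b) \<in> \<Gamma> i \<Longrightarrow> z \<in> closed_segment a b \<Longrightarrow> u \<in> closed_segment a b \<and> v \<in> closed_segment a b"
proof (cases "t = 0 \<or> t = 1 \<or> u = v")
  case True
  then show thesis using assms(2) K unfolding krep_def by auto
next
  case False
  have k: "u \<in> K" "v \<in> K" "unsep u v" "0 < t" "t < 1" "z = mix t u v" "u \<noteq> v"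
    using assms(2) False unfolding krep_def by auto
  have d: "u \<in> disc" "v \<in> disc" using k K_disc by blast+
  then have z1: "norm z < 1" using mix_in_ball k by blast
  have op: "z \<in> open_segment u v" using k open_segment_mix by blast
  have on: "u \<in> closed_segment a b \<and> v \<in> closed_segment a b" if "(a, b) \<in> \<Gamma> i" "z \<in> closed_segment a b" for i a b
  proof -
    have "side a b u = 0" "side a b v = 0"
      using unsep_mix_leaf[OF k(3,4,5) that(1)] segment_side_0[OF that(2)] k(6) by auto
    then show ?thesis
      using side_0_segment leaf_circle[OF that(1)] leaf_nondegenerate[OF that z1] d by blast
  qed
  obtain i a b where "(a, b) \<in> \<Gamma> i" "z \<in> closed_segment a b" using Y_ballE[OF assms(1) z1] by metis
  then have "z \<notin> K" using K_separates[OF _ _ _ op] on k(3) by blast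
  then show thesis using gap z1 k on op by blast
qed

text \<open>In a gap both pairs span segments of one leaf around \<open>z\<close>. An end of one
  interior to the other would be a point of \<open>K\<close> separating unseparated points, so the
  pairs agree up to order, and a swap turns \<open>t\<close> into \<open>1 - t\<close>.\<close>

lemma krep_unique:
  assumes "z \<in> Y" "krep z u v t" "krep z u' v' t'"
  shows "mix t (\<phi> u) (\<phi> v) = mix t' (\<phi> u') (\<phi> v')"
  using assms(1,2)
proof (cases rule: krep_cases)
  case K
  show ?thesis using assms(1,3) by (cases rule: krep_cases) (use K in auto)
next
  case gap
  note g = gap
  show ?thesis using assms(1,3)
  proof (cases rule: krep_cases)
    case K
    then show ?thesis using g by simp
  next
    case gap
    obtain i a b where ab: "(a, b) \<in> \<Gamma> i" "z \<in> closed_segment a b" using Y_ballE[OF assms(1) g(2)] by metis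
    have s: "u \<in> closed_segment a b" "v \<in> closed_segment a b" "u' \<in> closed_segment a b" "v' \<in> closed_segment a b"
      using g(7) gap(7) ab by blast+
    have no: "u \<notin> open_segment u' v'" "v \<notin> open_segment u' v'" "u' \<notin> open_segment u v" "v' \<notin> open_segment u v"
      using K_separates[OF ab(1)] s assms(2,3) unfolding krep_def by blast+
    have "u \<in> closed_segment u' v'" "v \<in> closed_segment u' v'"
      using segment_overlap[OF s g(6) gap(6)] no by blast+
    then consider "u = u'" "v = v'" | "u = v'" "v = u'"
      using no g(5) unfolding open_segment_def by blast
    then show ?thesis
    proof cases
      case 1 then show ?thesis using assms(2,3) g(5) mix_inj unfolding krep_def by metis
    next
      case 2
      then have "t' = 1 - t" using assms(2,3) g(5) mix_inj mix_swap unfolding krep_def by metis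
      then show ?thesis using 2 mix_swap[of "1 - t" "\<phi> v" "\<phi> u"] by simp
    qed
  qed
qed

lemma nearest_K:
  assumes "a \<in> K"
  obtains u where "u \<in> K" "u \<in> closed_segment z a" "open_segment z u \<inter> K = {}"
proof -
  have ne: "K \<inter> closed_segment z a \<noteq> {}" using assms by auto
  have "closed (K \<inter> closed_segment z a)" using compact_K by (simp add: closed_Int compact_imp_closed)
  then obtain u where u: "u \<in> K \<inter> closed_segment z a" "\<And>y. y \<in> K \<inter> closed_segment z a \<Longrightarrow> dist z u \<le> dist z y"
    using distance_attains_inf ne by blast
  have "y \<notin> K" if "y \<in> open_segment z u" for y
  proof
    assume "y \<in> K"
    have "y \<in> closed_segment z a"
      using that u(1) by (meson IntD2 closed_segment_subset convex_closed_segment ends_in_segment(1) open_closed_segment subsetD)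
    then have "dist z u \<le> dist z y" using u(2) \<open>y \<in> K\<close> by blast
    then show False using dist_in_open_segment[OF that] by (simp add: dist_commute)
  qed
  then show thesis using that u(1) by blast
qed

text \<open>Follow the leaf from \<open>z\<close> in both directions to the nearest points of
  \<open>K\<close>; they exist because \<open>K\<close> is closed and contains the ends of the
  leaf.\<close>

lemma krep_exists:
  assumes "z \<in> Y"
  shows "\<exists>u v t. krep z u v t"
proof (cases "z \<in> K")
  case True
  then have "krep z z z 0" unfolding krep_def by (simp add: unsep_refl)
  then show ?thesis by blast
next
  case False
  then have z1: "norm z < 1" using assms Y_disc circle_K disc_cases[of z] by blast
  obtain i a b where ab: "(a, b) \<in> \<Gamma> i" "z \<in> closed_segment a b" "a \<noteq> b" using Y_ballE[OF assms z1] by metis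
  have ends: "a \<in> K" "b \<in> K" using leaf_circle[OF ab(1)] circle_K by blast+
  obtain u where u: "u \<in> K" "u \<in> closed_segment z a" "open_segment z u \<inter> K = {}"
    using nearest_K[OF ends(1)] by blast
  obtain v where v: "v \<in> K" "v \<in> closed_segment z b" "open_segment z v \<inter> K = {}"
    using nearest_K[OF ends(2)] by blast
  have "z \<in> closed_segment b u"
    using segment_tail[OF ab(2) u(2)] by (simp add: closed_segment_commute)
  then have zv: "z \<in> closed_segment v u"
    using segment_tail v(2) by blast
  have "closed_segment v u \<subseteq> closed_segment v z \<union> closed_segment z u"
    using Un_closed_segment[OF zv] by simp
  then have "open_segment u v \<inter> K = {}"
    using u(3) v(3) False unfolding open_segment_def by (auto simp: closed_segment_commute)
  moreover have "u \<in> closed_segment a b" "v \<in> closed_segment a b"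
    using u(2) v(2) ab(2) by (meson closed_segment_subset convex_closed_segment ends_in_segment subsetD)+
  ultimately have "unsep u v" using unsep_avoid_K[OF ab(1)] by blast
  then show ?thesis
    using zv u(1) v(1) unfolding krep_def closed_segment_mix by (metis unsep_sym)
qed

definition \<psi> :: "complex \<Rightarrow> complex" where
  "\<psi> z = (SOME w. \<exists>u v t. krep z u v t \<and> w = mix t (\<phi> u) (\<phi> v))"

lemma \<psi>_krep:
  assumes "z \<in> Y" "krep z u v t"
  shows "\<psi> z = mix t (\<phi> u) (\<phi> v)"
proof -
  have "\<exists>w u v t. krep z u v t \<and> w = mix t (\<phi> u) (\<phi> v)" using assms(2) by blast
  from someI_ex[OF this] obtain u' v' t' where "krep z u' v' t'" "\<psi> z = mix t' (\<phi> u') (\<phi> v')"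
    unfolding \<psi>_def by blast
  then show ?thesis using krep_unique[OF assms(1)] assms(2) by metis
qed

lemma krep_self: "z \<in> K \<Longrightarrow> krep z z z 0"
  by (simp add: krep_def unsep_refl)

lemma \<psi>_K: "z \<in> K \<Longrightarrow> \<psi> z = \<phi> z"
  using \<psi>_krep[OF _ krep_self] K_Y by auto

lemma \<psi>_circle: "z \<in> circle \<Longrightarrow> \<psi> z = f z"
  using \<psi>_K \<phi>_circle circle_K by auto

text \<open>The gap is found from a representation of the midpoint of \<open>p\<close> and
  \<open>q\<close>: its ends cannot be interior to the segment from \<open>p\<close> to
  \<open>q\<close> without separating the two, so they enclose it.\<close>

lemma leaf_gap:
  assumes ab: "(a, b) \<in> \<Gamma> i" and pq: "p \<in> closed_segment a b" "q \<in> closed_segment a b" "p \<noteq> q" "unsep p q"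
  obtains u v where "u \<in> K" "v \<in> K" "unsep u v" "u \<noteq> v" "u \<in> closed_segment a b" "v \<in> closed_segment a b"
    "p \<in> closed_segment u v" "q \<in> closed_segment u v"
proof -
  define m where "m = mix (1/2) p q"
  have m: "m \<in> open_segment p q"
    unfolding open_segment_mix m_def using pq(3) by (intro conjI exI[of _ "1/2"]) auto
  have mab: "m \<in> closed_segment a b"
    using m pq(1,2) by (meson closed_segment_subset convex_closed_segment open_closed_segment subsetD)
  have mY: "m \<in> Y" using leaf_Y[OF ab mab] .
  have mK: "m \<notin> K" using K_separates[OF ab pq(1,2) m] pq(4) by blast
  obtain u v t where k: "krep m u v t" using krep_exists[OF mY] by blast
  show thesis using mY k
  proof (cases rule: krep_cases)
    case K then show ?thesis using mK by simp
  next
    case gap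
    have uv: "u \<in> closed_segment a b" "v \<in> closed_segment a b" using gap(7)[OF ab mab] by auto
    have kuv: "u \<in> K" "v \<in> K" "unsep u v" using k unfolding krep_def by blast+
    then have "u \<notin> open_segment p q" "v \<notin> open_segment p q"
      using K_separates[OF ab pq(1,2)] pq(4) by blast+
    then have "p \<in> closed_segment u v" "q \<in> closed_segment u v"
      using segment_overlap[OF pq(1,2) uv m gap(6)] by blast+
    then show ?thesis using that kuv uv gap(5) by blast
  qed
qed

lemma \<psi>_gap:
  assumes "(a, b) \<in> \<Gamma> i" "u \<in> K" "v \<in> K" "unsep u v" "u \<in> closed_segment a b" "v \<in> closed_segment a b"
    and "0 \<le> t" "t \<le> 1"
  shows "\<psi> (mix t u v) = mix t (\<phi> u) (\<phi> v)"
proof -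
  have "mix t u v \<in> closed_segment a b"
    using assms(5-8) by (meson closed_segment_subset convex_closed_segment mix_in_closed subsetD)
  then have "mix t u v \<in> Y" using leaf_Y assms(1) by blast
  then show ?thesis using \<psi>_krep assms unfolding krep_def by blast
qed

text \<open>A leaf through a proper combination contains \<open>p\<close> and \<open>q\<close> as
  well; being unseparated, they share a closed gap of that leaf, and \<open>\<psi>\<close> is affine
  there.\<close>

lemma \<psi>_mix:
  assumes "p \<in> Y" "q \<in> Y" "unsep p q" "0 \<le> t" "t \<le> 1" "mix t p q \<in> Y"
  shows "\<psi> (mix t p q) = mix t (\<psi> p) (\<psi> q)"
proof (cases "t = 0 \<or> t = 1 \<or> p = q")
  case True then show ?thesis by auto
next
  case False
  have d: "p \<in> disc" "q \<in> disc" using assms(1,2) Y_disc by blast+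
  have t: "0 < t" "t < 1" and "p \<noteq> q" using False assms(4,5) by auto
  then have n: "norm (mix t p q) < 1" using mix_in_ball[OF d] by blast
  obtain i a b where ab: "(a, b) \<in> \<Gamma> i" "mix t p q \<in> closed_segment a b" "a \<noteq> b" "a \<in> circle" "b \<in> circle"
    using Y_ballE[OF assms(6) n] by metis
  have "side a b p = 0" "side a b q = 0"
    using unsep_mix_leaf[OF assms(3) t ab(1)] segment_side_0[OF ab(2)] by auto
  then have pq: "p \<in> closed_segment a b" "q \<in> closed_segment a b"
    using side_0_segment[OF ab(4,5,3)] d by blast+
  obtain u v where uv: "u \<in> K" "v \<in> K" "unsep u v" "u \<noteq> v" "u \<in> closed_segment a b" "v \<in> closed_segment a b"
    "p \<in> closed_segment u v" "q \<in> closed_segment u v"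
    using leaf_gap[OF ab(1) pq \<open>p \<noteq> q\<close> assms(3)] by blast
  obtain x where x: "0 \<le> x" "x \<le> 1" "p = mix x u v" using uv(7) closed_segment_mix by metis
  obtain y where y: "0 \<le> y" "y \<le> 1" "q = mix y u v" using uv(8) closed_segment_mix by metis
  have "0 \<le> (1 - t) * x + t * y" using x y t by simp
  moreover have "(1 - t) * x + t * y \<le> (1 - t) * 1 + t * 1" using x y t by (intro add_mono mult_left_mono) auto
  ultimately have "\<psi> (mix t p q) = mix ((1 - t) * x + t * y) (\<phi> u) (\<phi> v)"
    unfolding x(3) y(3) mix_mix by (intro \<psi>_gap[OF ab(1) uv(1,2,3,5,6)]) simp_all
  then show ?thesis
    unfolding x(3) y(3) using \<psi>_gap[OF ab(1) uv(1,2,3,5,6)] x y by (simp add: mix_mix)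
qed

lemma \<psi>_disc: "z \<in> Y \<Longrightarrow> \<psi> z \<in> disc"
  and \<psi>_interior: "z \<in> Y \<Longrightarrow> norm z < 1 \<Longrightarrow> norm (\<psi> z) < 1"
  and \<psi>_compat: "z \<in> Y \<Longrightarrow> compat z (\<psi> z)"
proof -
  have *: "\<psi> z \<in> disc \<and> (norm z < 1 \<longrightarrow> norm (\<psi> z) < 1) \<and> compat z (\<psi> z)" if zY: "z \<in> Y" for z
  proof -
    obtain u v t where k: "krep z u v t" using krep_exists[OF zY] by blast
    note \<psi> = \<psi>_krep[OF zY k]
    show ?thesis using zY k
    proof (cases rule: krep_cases)
      case K
      then show ?thesis using \<phi>_disc \<phi>_interior \<phi>_compat \<psi> by metis
    next
      case gap
      have uv: "u \<in> K" "v \<in> K" "unsep u v" "z = mix t u v" using k unfolding krep_def by blast+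
      have "\<phi> u \<noteq> \<phi> v" using \<phi>_inj uv gap(5) by (auto dest: inj_onD)
      then have "norm (\<psi> z) < 1"
        unfolding \<psi> using mix_in_ball \<phi>_disc uv gap(3,4) by blast
      moreover have "compat z (\<psi> z)"
        unfolding \<psi> unfolding uv(4)
        using compat_mix[OF \<phi>_compat[OF uv(1)] \<phi>_compat[OF uv(2)] uv(3)] gap(3,4) by blast
      ultimately show ?thesis by simp
    qed
  qed
  show "z \<in> Y \<Longrightarrow> \<psi> z \<in> disc" "z \<in> Y \<Longrightarrow> norm z < 1 \<Longrightarrow> norm (\<psi> z) < 1" "z \<in> Y \<Longrightarrow> compat z (\<psi> z)"
    using * by blast+
qed

text \<open>Equal images force equal sides, hence a common leaf and a common gap. There
  \<open>\<psi>\<close> is affine, and not constant because \<open>\<phi>\<close> is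
  injective.\<close>

lemma \<psi>_inj: "inj_on \<psi> Y"
proof (rule inj_onI)
  fix p q assume pq: "p \<in> Y" "q \<in> Y" "\<psi> p = \<psi> q"
  have ss: "same_sides p q" using compat_same_sides \<psi>_compat pq by metis
  have norms: "p \<in> circle \<longleftrightarrow> q \<in> circle"
    using \<psi>_interior \<psi>_circle f_circle pq Y_disc disc_cases by (metis mem_sphere_0 order_less_irrefl subsetD)
  show "p = q"
  proof (cases "p \<in> circle")
    case True
    then show ?thesis using norms pq(3) \<psi>_circle inj_f by (metis inj_onD)
  next
    case False
    then have p1: "norm p < 1" and q1: "norm q < 1" using norms pq Y_disc disc_cases by blast+
    obtain i a b where ab: "(a, b) \<in> \<Gamma> i" "p \<in> closed_segment a b" "a \<noteq> b" "a \<in> circle" "b \<in> circle"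
      using Y_ballE[OF pq(1) p1] by metis
    have "side a b q = 0" using ss ab(1) segment_side_0[OF ab(2)] unfolding same_sides_def by (metis sgn_0_0)
    then have q: "q \<in> closed_segment a b" using side_0_segment[OF ab(4,5,3)] q1 by simp
    show ?thesis
    proof (rule ccontr)
      assume "p \<noteq> q"
      then obtain u v where uv: "u \<in> K" "v \<in> K" "unsep u v" "u \<noteq> v" "u \<in> closed_segment a b" "v \<in> closed_segment a b"
        "p \<in> closed_segment u v" "q \<in> closed_segment u v"
        using leaf_gap[OF ab(1,2) q _ same_sides_unsep[OF ss]] by metis
      obtain x where x: "0 \<le> x" "x \<le> 1" "p = mix x u v" using uv(7) closed_segment_mix by metis
      obtain y where y: "0 \<le> y" "y \<le> 1" "q = mix y u v" using uv(8) closed_segment_mix by metis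
      have "\<phi> u \<noteq> \<phi> v" using \<phi>_inj uv by (auto dest: inj_onD)
      moreover have "mix x (\<phi> u) (\<phi> v) = mix y (\<phi> u) (\<phi> v)"
        using pq(3) \<psi>_gap[OF ab(1) uv(1,2,3,5,6)] x y by metis
      ultimately have "x = y" using mix_inj by metis
      then show False using x(3) y(3) \<open>p \<noteq> q\<close> by simp
    qed
  qed
qed

text \<open>The data of \<open>krep\<close> range over a compact set and its conditions are closed,
  so representations of \<open>X n\<close> subconverge to one of \<open>z\<close>; by
  \<open>krep_unique\<close> any representation of \<open>z\<close> will do.\<close>

lemma \<psi>_continuous: "continuous_on Y \<psi>"
proof (rule continuous_on_sequential_graph)
  show "closed Y" using compact_Y compact_imp_closed by blast
  show "compact disc" by simp
  show "\<And>z. z \<in> Y \<Longrightarrow> \<psi> z \<in> disc" by (rule \<psi>_disc)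
  fix X z w assume X: "\<And>n. X n \<in> Y" "X \<longlonglongrightarrow> z" "z \<in> Y" "(\<lambda>n. \<psi> (X n)) \<longlonglongrightarrow> w"
  obtain U V T where k: "\<And>n. krep (X n) (U n) (V n) (T n)" using krep_exists[OF X(1)] by metis
  have "compact (K \<times> K \<times> {0..1::real})" by (intro compact_Times compact_K) simp
  moreover have "\<forall>n. (U n, V n, T n) \<in> K \<times> K \<times> {0..1}" using k unfolding krep_def by auto
  ultimately obtain l r where l: "l \<in> K \<times> K \<times> {0..1}" and r: "strict_mono r" "((\<lambda>n. (U n, V n, T n)) \<circ> r) \<longlonglongrightarrow> l"
    unfolding compact_def by meson
  obtain u v t where luv: "l = (u, v, t)" by (cases l) auto
  have UK: "U n \<in> K" "V n \<in> K" for n using k unfolding krep_def by blast+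
  have uv: "u \<in> K" "v \<in> K" "0 \<le> t" "t \<le> 1" using l luv by auto
  have lim: "(\<lambda>n. U (r n)) \<longlonglongrightarrow> u" "(\<lambda>n. V (r n)) \<longlonglongrightarrow> v" "(\<lambda>n. T (r n)) \<longlonglongrightarrow> t"
    using tendsto_fst[OF r(2)] tendsto_fst[OF tendsto_snd[OF r(2)]] tendsto_snd[OF tendsto_snd[OF r(2)]]
    by (simp_all add: luv o_def)
  have "unsep u v" using unsep_limit[OF lim(1,2)] k unfolding krep_def by blast
  have Xr: "(\<lambda>n. X (r n)) \<longlonglongrightarrow> z" "(\<lambda>n. \<psi> (X (r n))) \<longlonglongrightarrow> w"
    using LIMSEQ_subseq_LIMSEQ[OF X(2) r(1)] LIMSEQ_subseq_LIMSEQ[OF X(4) r(1)] by (simp_all add: o_def)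
  have "X (r n) = mix (T (r n)) (U (r n)) (V (r n))" for n using k unfolding krep_def by blast
  then have "(\<lambda>n. X (r n)) \<longlonglongrightarrow> mix t u v" by (simp only:) (intro tendsto_mix lim)
  then have z: "z = mix t u v" using LIMSEQ_unique Xr(1) by blast
  then have kz: "krep z u v t" using uv \<open>unsep u v\<close> unfolding krep_def by blast
  have "(\<lambda>n. \<phi> (U (r n))) \<longlonglongrightarrow> \<phi> u" "(\<lambda>n. \<phi> (V (r n))) \<longlonglongrightarrow> \<phi> v"
    using continuous_on_tendsto_compose[OF \<phi>_continuous lim(1) uv(1)]
      continuous_on_tendsto_compose[OF \<phi>_continuous lim(2) uv(2)] UK by simp_all
  then have "(\<lambda>n. mix (T (r n)) (\<phi> (U (r n))) (\<phi> (V (r n)))) \<longlonglongrightarrow> mix t (\<phi> u) (\<phi> v)"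
    by (intro tendsto_mix lim)
  moreover have "\<psi> (X (r n)) = mix (T (r n)) (\<phi> (U (r n))) (\<phi> (V (r n)))" for n
    using \<psi>_krep X(1) k by blast
  ultimately have "w = mix t (\<phi> u) (\<phi> v)" using LIMSEQ_unique Xr(2) by simp
  then show "\<psi> z = w" using \<psi>_krep[OF X(3) kz] by simp
qed

section \<open>Gaps of \<open>Y\<close> and their cone points\<close>

lemma open_gaps: "disc - Y = ball 0 1 - Y" "open (disc - Y)"
proof -
  show *: "disc - Y = ball 0 1 - Y" using circle_K K_Y by force
  show "open (disc - Y)" unfolding * using compact_Y by (simp add: open_Diff compact_imp_closed)
qed

lemma unsep_same_sides:
  assumes "p \<in> disc - Y" "q \<in> disc - Y" "unsep p q"
  shows "same_sides p q"
  unfolding same_sides_def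
proof (intro allI impI)
  fix i a b assume ab: "(a, b) \<in> \<Gamma> i"
  show "sgn (side a b p) = sgn (side a b q)"
  proof (cases "a = b")
    case False
    have "side a b p \<noteq> 0" "side a b q \<noteq> 0" using leaf_side_Y[OF ab False] assms by blast+
    moreover have "side a b p * side a b q \<ge> 0" using assms(3) ab unfolding unsep_def by blast
    ultimately show ?thesis by (auto simp: sgn_if zero_le_mult_iff)
  qed simp
qed

lemma same_sides_Y:
  assumes "same_sides p q" "p \<in> Y" "norm p < 1" "q \<in> disc"
  shows "q \<in> Y"
proof -
  obtain i a b where ab: "(a, b) \<in> \<Gamma> i" "p \<in> closed_segment a b" "a \<noteq> b" using Y_ballE[OF assms(2,3)] by metis
  then have "side a b q = 0" using assms(1) segment_side_0 unfolding same_sides_def by (metis sgn_0_0)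
  then show ?thesis using leaf_side_Y ab assms(4) by blast
qed

lemma same_sides_sym: "same_sides p q \<Longrightarrow> same_sides q p"
  unfolding same_sides_def by metis

lemma same_sides_trans: "same_sides p q \<Longrightarrow> same_sides q r \<Longrightarrow> same_sides p r"
  unfolding same_sides_def by metis

lemma gap_ray:
  assumes "p \<in> disc - Y" "l \<noteq> 0"
  obtains d where "0 < d" "p + d *\<^sub>R l \<in> Y" "\<And>e. 0 \<le> e \<Longrightarrow> e < d \<Longrightarrow> p + e *\<^sub>R l \<in> disc - Y"
proof -
  have int: "interior (disc - Y) = disc - Y" using open_gaps(2) interior_open by blast
  have "bounded (disc - Y)" by (simp add: bounded_diff)
  then obtain d where d: "0 < d" "p + d *\<^sub>R l \<in> frontier (disc - Y)"
    "\<And>e. 0 \<le> e \<Longrightarrow> e < d \<Longrightarrow> p + e *\<^sub>R l \<in> disc - Y"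
    using ray_to_frontier[of "disc - Y" p l] assms unfolding int by blast
  have "closure (disc - Y) \<subseteq> disc" by (rule closure_minimal) auto
  then have "p + d *\<^sub>R l \<in> Y" using d(2) unfolding frontier_def int by blast
  then show thesis using that d by blast
qed

text \<open>The point \<open>z\<close> enters only through its class under
  \<open>same_sides\<close>, so one choice serves a whole gap. Recording the two points, not just
  their midpoint, is what lets the choice pass to limits.\<close>

definition central :: "complex \<Rightarrow> complex \<times> complex \<Rightarrow> bool" where
  "central z p \<longleftrightarrow> fst p \<in> Y \<and> snd p \<in> Y \<and> fst p \<noteq> snd p \<and> unsep (fst p) (snd p) \<and>
     same_sides z (mix (1/2) (fst p) (snd p))"

text \<open>The pair consists of the points where the horizontal line through \<open>z\<close> first
  meets \<open>Y\<close> on either side.\<close>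

lemma central_exists:
  assumes z: "z \<in> disc - Y"
  shows "\<exists>p. central z p"
proof -
  obtain d where d: "0 < d" "z + d *\<^sub>R 1 \<in> Y" "\<And>e. 0 \<le> e \<Longrightarrow> e < d \<Longrightarrow> z + e *\<^sub>R 1 \<in> disc - Y"
    using gap_ray[OF z, of 1] by auto
  obtain d' where d': "0 < d'" "z + d' *\<^sub>R (-1) \<in> Y" "\<And>e. 0 \<le> e \<Longrightarrow> e < d' \<Longrightarrow> z + e *\<^sub>R (-1) \<in> disc - Y"
    using gap_ray[OF z, of "-1"] by auto
  define u v where "u = z + d *\<^sub>R 1" and "v = z + d' *\<^sub>R (-1)"
  have mix: "mix t u v = z + ((1 - t) * d - t * d') *\<^sub>R 1" for t
    unfolding mix_def u_def v_def by (simp add: algebra_simps)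
  have uv: "u \<noteq> v"
  proof
    assume "u = v"
    then have "(d + d') *\<^sub>R (1::complex) = 0" by (simp add: u_def v_def algebra_simps)
    then show False using d(1) d'(1) by simp
  qed
  have gap: "k \<in> disc - Y" if k: "k \<in> open_segment u v" for k
  proof -
    obtain t where t: "0 < t" "t < 1" "k = mix t u v" using k open_segment_mix by metis
    \<comment> \<open>The signed position of \<open>k\<close> relative to \<open>z\<close>, positive
      towards \<open>u\<close> and negative towards \<open>v\<close>.\<close>
    define e where "e = (1 - t) * d - t * d'"
    have "k = z + e *\<^sub>R 1" using t(3) mix e_def by simp
    then have ke: "k = z + e *\<^sub>R 1" "k = z + (- e) *\<^sub>R (-1)" by simp_all
    have "t * d > 0" "t * d' > 0" "(1 - t) * d > 0" "(1 - t) * d' > 0" using t d(1) d'(1) by simp_all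
    moreover have "e = d - t * d - t * d'" "- e = d' - (1 - t) * d - (1 - t) * d'"
      by (simp_all add: e_def algebra_simps)
    ultimately have "e < d" "- e < d'" by linarith+
    then show ?thesis using d(3)[of e] d'(3)[of "- e"] ke by (cases "0 \<le> e") auto
  qed
  \<comment> \<open>The point \<open>z\<close> has distance \<open>d\<close> from \<open>u\<close>
    and \<open>d'\<close> from \<open>v\<close>, which gives its weight on the segment.\<close>
  have "d / (d + d') < 1" "0 < d / (d + d')" using d(1) d'(1) by simp_all
  moreover have "z = mix (d / (d + d')) u v"
  proof -
    have "(1 - d / (d + d')) * d - d / (d + d') * d' = 0" using d(1) d'(1) by (simp add: field_simps)
    then show ?thesis unfolding mix by simp
  qed
  ultimately have zo: "z \<in> open_segment u v" using uv open_segment_mix by blast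
  define c where "c = mix (1/2) u v"
  have co: "c \<in> open_segment u v" unfolding c_def open_segment_mix using uv by (intro conjI exI[of _ "1/2"]) auto
  have ud: "u \<in> disc" "v \<in> disc" using d(2) d'(2) Y_disc u_def v_def by blast+
  have "unsep u v" using unsep_avoid_Y[OF ud] gap by blast
  moreover have "open_segment z c \<subseteq> open_segment u v"
    using zo co by (meson closed_segment_subset convex_open_segment open_closed_segment subset_iff)
  then have "open_segment z c \<inter> Y = {}" using gap by blast
  then have "unsep z c" using unsep_avoid_Y z gap[OF co] by blast
  then have "same_sides z c" using unsep_same_sides z gap[OF co] by blast
  ultimately have "central z (u, v)"
    using uv d(2) d'(2) unfolding central_def c_def u_def v_def by simp
  then show ?thesis by blast
qed

definition cen :: "complex \<Rightarrow> complex \<times> complex" where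
  "cen z = (SOME p. central z p)"

definition cone_point :: "complex \<Rightarrow> complex" where
  "cone_point z = mix (1/2) (fst (cen z)) (snd (cen z))"

text \<open>It is built from the pair because the cone point of a gap lies outside \<open>Y\<close>,
  where \<open>\<psi>\<close> carries no information.\<close>

definition image_cone_point :: "complex \<Rightarrow> complex" where
  "image_cone_point z = mix (1/2) (\<psi> (fst (cen z))) (\<psi> (snd (cen z)))"

lemma cen_central: "z \<in> disc - Y \<Longrightarrow> central z (cen z)"
  unfolding cen_def using someI_ex[OF central_exists] .

text \<open>The choice operator sees only the predicate \<open>central z\<close>, which is the same
  for both points.\<close>

lemma cen_cong: "same_sides z z' \<Longrightarrow> cen z = cen z'"
proof -
  assume "same_sides z z'"
  then have "central z = central z'"
    unfolding central_def using same_sides_trans same_sides_sym by blast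
  then show ?thesis by (simp add: cen_def)
qed

lemma cone_point:
  assumes z: "z \<in> disc - Y"
  shows "same_sides z (cone_point z)" "cone_point z \<in> disc - Y"
    "compat (cone_point z) (image_cone_point z)" "norm (image_cone_point z) < 1"
proof -
  obtain u v where uv: "cen z = (u, v)" by fastforce
  have c: "u \<in> Y" "v \<in> Y" "u \<noteq> v" "unsep u v" "same_sides z (mix (1/2) u v)"
    using cen_central[OF z] unfolding central_def uv by auto
  then show ss: "same_sides z (cone_point z)" by (simp add: cone_point_def uv)
  have "norm (cone_point z) < 1"
    unfolding cone_point_def uv using mix_in_ball[OF subsetD[OF Y_disc c(1)] subsetD[OF Y_disc c(2)] c(3)] by simp
  moreover have "cone_point z \<notin> Y"
    using same_sides_Y[OF same_sides_sym[OF ss]] calculation z by blast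
  ultimately show "cone_point z \<in> disc - Y" by simp
  show "compat (cone_point z) (image_cone_point z)"
    unfolding cone_point_def image_cone_point_def uv using compat_mix[OF \<psi>_compat \<psi>_compat] c by simp
  have "\<psi> u \<noteq> \<psi> v" using \<psi>_inj c by (auto dest: inj_onD)
  then show "norm (image_cone_point z) < 1"
    unfolding image_cone_point_def uv using mix_in_ball[of "\<psi> u" "\<psi> v" "1/2"] \<psi>_disc c by simp
qed

section \<open>Cone coordinates in a gap\<close>

definition crep :: "complex \<Rightarrow> complex \<Rightarrow> complex \<Rightarrow> real \<Rightarrow> bool" where
  "crep c z b s \<longleftrightarrow> b \<in> Y \<and> unsep c b \<and> 0 \<le> s \<and> s \<le> 1 \<and> z = mix s c b"

text \<open>A leaf through \<open>b\<close> does not separate \<open>c\<close> from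
  \<open>b'\<close>, so it would contain \<open>c\<close>. Thus a point \<open>b'\<close> of
  \<open>Y\<close> unseparated from \<open>c\<close> is the first point of \<open>Y\<close> on its
  ray.\<close>

lemma Y_not_inside:
  assumes "c \<in> disc - Y" "b \<in> Y" "b' \<in> disc" "unsep c b'" "b \<in> open_segment c b'"
  shows False
proof -
  obtain t where t: "0 < t" "t < 1" "b = mix t c b'" "c \<noteq> b'" using assms(5) open_segment_mix by metis
  have "norm b < 1" using mix_in_ball[of c b' t] t assms by auto
  then obtain i p q where pq: "(p, q) \<in> \<Gamma> i" "b \<in> closed_segment p q" "p \<noteq> q" using Y_ballE[OF assms(2)] by metis
  have "side p q c = 0" using unsep_mix_leaf[OF assms(4) t(1,2) pq(1)] segment_side_0[OF pq(2)] t(3) by auto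
  then show False using leaf_side_Y[OF pq(1,3)] assms(1) by blast
qed

lemma crep_exists:
  assumes c: "c \<in> disc - Y" and z: "z \<in> disc - Y" and ss: "same_sides z c"
  shows "\<exists>b s. crep c z b s"
proof -
  \<comment> \<open>At the cone point itself any direction will do, since the weight is then
    0.\<close>
  define l where "l = (if z = c then 1 else z - c)"
  have "l \<noteq> 0" by (simp add: l_def)
  then obtain d where d: "0 < d" "c + d *\<^sub>R l \<in> Y" "\<And>e. 0 \<le> e \<Longrightarrow> e < d \<Longrightarrow> c + e *\<^sub>R l \<in> disc - Y"
    using gap_ray[OF c] by blast
  define b where "b = c + d *\<^sub>R l"
  have mix: "mix t c b = c + (t * d) *\<^sub>R l" for t by (simp add: mix_def b_def algebra_simps)
  have "open_segment c b \<inter> Y = {}"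
  proof -
    have "k \<notin> Y" if "k \<in> open_segment c b" for k
    proof -
      obtain t where t: "0 < t" "t < 1" "k = mix t c b" using \<open>k \<in> open_segment c b\<close> open_segment_mix by metis
      have "t * d < d" "0 \<le> t * d" using t d(1) by simp_all
      then show ?thesis using d(3) t(3) mix by auto
    qed
    then show ?thesis by blast
  qed
  moreover have bY: "b \<in> Y" using d(2) b_def by simp
  ultimately have un: "unsep c b" using unsep_avoid_Y[of c b] c Y_disc by blast
  show ?thesis
  proof (cases "z = c")
    case True
    then have "crep c z b 0" using bY un by (simp add: crep_def)
    then show ?thesis by blast
  next
    case False
    then have l: "l = z - c" by (simp add: l_def)
    \<comment> \<open>Here \<open>z\<close> is the point of the ray at parameter 1, and a point of
      \<open>Y\<close> strictly between \<open>c\<close> and \<open>z\<close> is excluded by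
      \<open>Y_not_inside\<close>.\<close>
    have "d > 1"
    proof (rule ccontr)
      assume "\<not> d > 1"
      moreover have "d \<noteq> 1" using bY z by (auto simp: b_def l)
      ultimately have "d < 1" by simp
      moreover have "b = mix d c z" by (simp add: b_def l mix_def algebra_simps)
      ultimately have "b \<in> open_segment c z" using d(1) False open_segment_mix by blast
      then show False
        using Y_not_inside[OF c bY _ same_sides_unsep[OF same_sides_sym[OF ss]]] z by blast
    qed
    then have "z = mix (1/d) c b" unfolding mix l by simp
    then have "crep c z b (1/d)" using bY un \<open>d > 1\<close> by (simp add: crep_def)
    then show ?thesis by blast
  qed
qed

text \<open>Unless both weights are 0, \<open>b\<close> and \<open>b'\<close> are the first point of
  \<open>Y\<close> on the same ray. The argument takes place in the source, so \<open>c'\<close> is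
  arbitrary.\<close>

lemma crep_unique:
  assumes c: "c \<in> disc - Y" and "crep c z b s" "crep c z b' s'"
  shows "mix s c' (\<psi> b) = mix s' c' (\<psi> b')"
proof -
  have r: "b \<in> Y" "b' \<in> Y" "unsep c b" "unsep c b'" "0 \<le> s" "0 \<le> s'" "mix s c b = mix s' c b'"
    using assms(2,3) unfolding crep_def by auto
  have ne: "c \<noteq> b" "c \<noteq> b'" using c r by blast+
  have d: "b \<in> disc" "b' \<in> disc" using r Y_disc by blast+
  have "b \<notin> open_segment c b'" "b' \<notin> open_segment c b"
    using Y_not_inside[OF c] r d by blast+
  then have "s = 0 \<and> s' = 0 \<or> b = b' \<and> s = s'" using mix_cone[OF ne r(5,6,7)] by blast
  then show ?thesis by auto
qed

section \<open>The map on the disc\<close>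

definition F :: "complex \<Rightarrow> complex" where
  "F z = (if z \<in> Y then \<psi> z
     else SOME w. \<exists>b s. crep (cone_point z) z b s \<and> w = mix s (image_cone_point z) (\<psi> b))"

lemma F_Y: "z \<in> Y \<Longrightarrow> F z = \<psi> z"
  by (simp add: F_def)

lemma F_circle: "z \<in> circle \<Longrightarrow> F z = f z"
  using F_Y \<psi>_circle circle_K K_Y by (metis subsetD)

lemma F_crep:
  assumes "z \<in> disc - Y" "crep (cone_point z) z b s"
  shows "F z = mix s (image_cone_point z) (\<psi> b)"
proof -
  have "\<exists>w b s. crep (cone_point z) z b s \<and> w = mix s (image_cone_point z) (\<psi> b)" using assms(2) by blast
  from someI_ex[OF this] obtain b' s' where "crep (cone_point z) z b' s'" "F z = mix s' (image_cone_point z) (\<psi> b')"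
    unfolding F_def using assms(1) by auto
  then show ?thesis using crep_unique[OF cone_point(2)[OF assms(1)]] assms(2) by metis
qed

lemma F_crep_exists:
  assumes "z \<in> disc - Y"
  obtains b s where "crep (cone_point z) z b s" "s < 1" "F z = mix s (image_cone_point z) (\<psi> b)"
proof -
  obtain b s where b: "crep (cone_point z) z b s"
    using crep_exists[OF cone_point(2) _ cone_point(1)] assms by blast
  have "s \<noteq> 1" using b assms unfolding crep_def by auto
  then have "s < 1" using b unfolding crep_def by auto
  then show thesis using that b F_crep[OF assms b] by blast
qed

lemma F_interior: "z \<in> disc \<Longrightarrow> norm z < 1 \<Longrightarrow> norm (F z) < 1"
  and F_compat: "z \<in> disc \<Longrightarrow> compat z (F z)"
proof -
  have *: "norm (F z) < 1 \<and> compat z (F z)" if z: "z \<in> disc - Y" for z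
  proof -
    obtain b s where b: "crep (cone_point z) z b s" "s < 1" "F z = mix s (image_cone_point z) (\<psi> b)"
      using F_crep_exists[OF z] by blast
    have r: "b \<in> Y" "unsep (cone_point z) b" "0 \<le> s" "z = mix s (cone_point z) b" using b(1) unfolding crep_def by auto
    have "norm (F z) < 1" unfolding b(3) using mix_norm_lt[OF cone_point(4)[OF z] \<psi>_disc] r b(2) by blast
    moreover have "compat z (F z)"
    \<comment> \<open>\<open>compat_mix\<close> needs proper weights; at weight 0 the point is the
      cone point itself.\<close>
    proof (cases "s = 0")
      case True then show ?thesis using cone_point(3)[OF z] b(3) r(4) by simp
    next
      case False
      then show ?thesis
        using compat_mix[OF cone_point(3)[OF z] \<psi>_compat[OF r(1)] r(2), of s s] r b(2,3) by simp
    qed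
    ultimately show ?thesis by blast
  qed
  show "z \<in> disc \<Longrightarrow> norm z < 1 \<Longrightarrow> norm (F z) < 1"
    using * \<psi>_interior F_Y by (cases "z \<in> Y") auto
  show "z \<in> disc \<Longrightarrow> compat z (F z)"
    using * \<psi>_compat F_Y by (cases "z \<in> Y") auto
qed

lemma F_disc: "z \<in> disc \<Longrightarrow> F z \<in> disc"
  using F_interior[of z] F_circle[of z] f_circle[of z] by (cases "norm z < 1") auto

lemma compat_unsep:
  assumes "compat u u'" "compat v v'" "unsep u v" "(a, b) \<in> \<Gamma> i"
  shows "side (f a) (f b) u' * side (f a) (f b) v' \<ge> 0"
proof -
  have "sgn (side (f a) (f b) u') = \<sigma> a b * sgn (side a b u)" "sgn (side (f a) (f b) v') = \<sigma> a b * sgn (side a b v)"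
    using assms unfolding compat_def by blast+
  then have "sgn (side (f a) (f b) u' * side (f a) (f b) v') = (\<sigma> a b)\<^sup>2 * sgn (side a b u * side a b v)"
    by (simp add: sgn_mult power2_eq_square)
  also have "\<dots> \<ge> 0" using assms(3,4) unfolding unsep_def by (intro mult_nonneg_nonneg) simp_all
  finally show ?thesis by (simp only: zero_le_sgn_iff)
qed

lemma \<psi>_interior_imp: "b \<in> Y \<Longrightarrow> norm (\<psi> b) < 1 \<Longrightarrow> norm b < 1"
  using \<psi>_circle[of b] f_circle[of b] Y_disc disc_cases[of b] by (metis mem_sphere_0 order_less_irrefl subsetD)

text \<open>The argument of \<open>Y_not_inside\<close> in the image: the image line of a leaf
  through \<open>b\<close> would contain \<open>c'\<close>, and \<open>compat\<close> carries this
  back to the leaf and \<open>c\<close>.\<close>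

lemma image_Y_not_inside:
  assumes "c \<in> disc - Y" "compat c c'" "norm c' < 1" "b \<in> Y" "b' \<in> Y" "unsep c b'"
    "\<psi> b \<in> open_segment c' (\<psi> b')"
  shows False
proof -
  obtain t where t: "0 < t" "t < 1" "\<psi> b = mix t c' (\<psi> b')" using assms(7) open_segment_mix by metis
  have "norm (\<psi> b) < 1" unfolding t(3) by (rule mix_norm_lt) (use assms(3,5) \<psi>_disc t in auto)
  then obtain i p q where pq: "(p, q) \<in> \<Gamma> i" "b \<in> closed_segment p q" "p \<noteq> q"
    using Y_ballE[OF assms(4)] \<psi>_interior_imp[OF assms(4)] by metis
  have "side (f p) (f q) (\<psi> b) = 0"
    using \<psi>_compat[OF assms(4)] pq(1) segment_side_0[OF pq(2)] unfolding compat_def by (metis mult_zero_right sgn_0_0)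
  then have "side (f p) (f q) c' = 0"
    using mix_zero(1)[OF compat_unsep[OF assms(2) \<psi>_compat[OF assms(5)] assms(6) pq(1)] t(1,2)]
    by (simp add: t(3) side_mix)
  then have "side p q c = 0"
    using assms(2) pq(1) \<sigma>_nonzero unfolding compat_def by (metis mult_eq_0_iff sgn_0_0)
  then show False using leaf_side_Y[OF pq(1,3)] assms(1) by blast
qed

text \<open>Equal images give equal sides, so both points lie in \<open>Y\<close>, where
  \<open>\<psi>\<close> is injective, or in one gap with a common cone point. In a gap
  \<open>mix_cone\<close> is applied to the image cone.\<close>

lemma F_inj: "inj_on F disc"
proof (rule inj_onI)
  fix p q assume pq: "p \<in> disc" "q \<in> disc" "F p = F q"
  have ss: "same_sides p q" using compat_same_sides F_compat pq by metis
  have norms: "p \<in> circle \<longleftrightarrow> q \<in> circle"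
    using F_interior F_circle f_circle pq disc_cases by (metis mem_sphere_0 order_less_irrefl)
  have YY: "p \<in> Y \<longleftrightarrow> q \<in> Y"
  proof (cases "p \<in> circle")
    case True then show ?thesis using norms circle_K K_Y by blast
  next
    case False
    then show ?thesis using same_sides_Y ss same_sides_sym norms disc_cases pq by metis
  qed
  show "p = q"
  proof (cases "p \<in> Y")
    case True
    then show ?thesis using YY pq(3) F_Y \<psi>_inj by (metis inj_onD)
  next
    case False
    then have g: "p \<in> disc - Y" "q \<in> disc - Y" using YY pq by blast+
    have ceq: "cone_point q = cone_point p" "image_cone_point q = image_cone_point p"
      using cen_cong[OF ss] by (simp_all add: cone_point_def image_cone_point_def)
    define c c' where "c = cone_point p" and "c' = image_cone_point p"
    have c: "c \<in> disc - Y" "compat c c'" "norm c' < 1" using cone_point[OF g(1)] c_def c'_def by auto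
    obtain b s where b: "crep c p b s" "F p = mix s c' (\<psi> b)"
      using F_crep_exists[OF g(1)] c_def c'_def by metis
    obtain b' s' where b': "crep c q b' s'" "F q = mix s' c' (\<psi> b')"
      using F_crep_exists[OF g(2)] ceq c_def c'_def by metis
    have r: "b \<in> Y" "unsep c b" "0 \<le> s" "p = mix s c b" using b(1) unfolding crep_def by auto
    have r': "b' \<in> Y" "unsep c b'" "0 \<le> s'" "q = mix s' c b'" using b'(1) unfolding crep_def by auto
    have ne: "c' \<noteq> \<psi> y" if "y \<in> Y" for y
    proof
      assume "c' = \<psi> y"
      then have "same_sides y c" "norm y < 1"
        using compat_same_sides \<psi>_compat[OF that] \<psi>_interior_imp[OF that] c by metis+
      then show False using same_sides_Y that c(1) by blast
    qed
    have "\<psi> b \<notin> open_segment c' (\<psi> b')" "\<psi> b' \<notin> open_segment c' (\<psi> b)"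
      using image_Y_not_inside[OF c] r r' by blast+
    then have "s = 0 \<and> s' = 0 \<or> \<psi> b = \<psi> b' \<and> s = s'"
      using mix_cone[OF ne[OF r(1)] ne[OF r'(1)] r(3) r'(3)] pq(3) b(2) b'(2) by simp
    then show ?thesis using r r' \<psi>_inj by (auto dest: inj_onD)
  qed
qed

text \<open>Two applications of \<open>\<psi>_mix\<close>. For \<open>s \<noteq> 1\<close> the
  midpoint of \<open>u\<close> and \<open>v\<close> also lies in \<open>Y\<close>: a leaf through
  the combination contains it, or it equals the combination or \<open>b\<close>.\<close>

lemma \<psi>_mix3:
  assumes "u \<in> Y" "v \<in> Y" "b \<in> Y" "unsep u v" "unsep (mix (1/2) u v) b" "0 \<le> s" "s \<le> 1"
    and z: "mix s (mix (1/2) u v) b \<in> Y"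
  shows "\<psi> (mix s (mix (1/2) u v) b) = mix s (mix (1/2) (\<psi> u) (\<psi> v)) (\<psi> b)"
proof (cases "s = 1")
  case False
  define c where "c = mix (1/2) u v"
  have d: "b \<in> disc" "c \<in> disc" unfolding c_def
    by (intro subsetD[OF Y_disc] mix_in_disc assms; simp)+
  have cY: "c \<in> Y"
  proof (cases "s = 0 \<or> mix s c b \<in> circle")
    case True
    then show ?thesis using mix_on_circle[OF d(2,1) assms(6,7)] False assms(3) z unfolding c_def by auto
  next
    case False
    have s: "0 < s" "s < 1" using False \<open>s \<noteq> 1\<close> assms(6,7) by auto
    have "norm (mix s c b) < 1" using False z Y_disc disc_cases unfolding c_def by blast
    then obtain i p q where pq: "(p, q) \<in> \<Gamma> i" "mix s c b \<in> closed_segment p q" "p \<noteq> q"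
      using Y_ballE z unfolding c_def by metis
    have "side p q c = 0"
      using unsep_mix_leaf[OF _ s pq(1)] assms(5) segment_side_0[OF pq(2)] unfolding c_def by auto
    then show ?thesis using leaf_side_Y[OF pq(1,3)] d(2) by blast
  qed
  have "\<psi> c = mix (1/2) (\<psi> u) (\<psi> v)"
    using \<psi>_mix[OF assms(1,2,4), of "1/2"] cY unfolding c_def by simp
  then show ?thesis using \<psi>_mix[OF cY assms(3) _ assms(6,7)] assms(5) z unfolding c_def by simp
qed simp

text \<open>All points of the disc are written as combinations with data in one compact set, so the
  data subconverge. A limit in \<open>Y\<close> is settled by \<open>\<psi>_mix3\<close>, one in a
  gap by the local constancy of \<open>cen\<close>.\<close>

lemma F_continuous: "continuous_on disc F"
proof (rule continuous_on_sequential_graph)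
  show "closed disc" "compact disc" by simp_all
  show "\<And>z. z \<in> disc \<Longrightarrow> F z \<in> disc" by (rule F_disc)
  fix X z w assume X: "\<And>n. X n \<in> disc" "X \<longlonglongrightarrow> z" "z \<in> disc" "(\<lambda>n. F (X n)) \<longlonglongrightarrow> w"
  have "\<exists>u v b s. u \<in> Y \<and> v \<in> Y \<and> b \<in> Y \<and> unsep u v \<and> unsep (mix (1/2) u v) b \<and> 0 \<le> s \<and> s \<le> 1 \<and>
      x = mix s (mix (1/2) u v) b \<and> F x = mix s (mix (1/2) (\<psi> u) (\<psi> v)) (\<psi> b) \<and>
      (x \<notin> Y \<longrightarrow> cen x = (u, v))" if x: "x \<in> disc" for x
  proof (cases "x \<in> Y")
    case True
    \<comment> \<open>A point of \<open>Y\<close> represents itself: all three points are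
      \<open>x\<close> and the weight is 0.\<close>
    then show ?thesis by (intro exI[of _ x] exI[of _ 0]) (simp add: unsep_refl F_Y)
  next
    case False
    then have g: "x \<in> disc - Y" using x by blast
    obtain b s where b: "crep (cone_point x) x b s" "F x = mix s (image_cone_point x) (\<psi> b)"
      using F_crep_exists[OF g] by metis
    show ?thesis
      using b cen_central[OF g] unfolding crep_def cone_point_def image_cone_point_def central_def
      by (intro exI[of _ "fst (cen x)"] exI[of _ "snd (cen x)"] exI[of _ b] exI[of _ s]) simp
  qed
  then have "\<forall>n. \<exists>u v b s. u \<in> Y \<and> v \<in> Y \<and> b \<in> Y \<and> unsep u v \<and> unsep (mix (1/2) u v) b \<and> 0 \<le> s \<and> s \<le> 1 \<and>
      X n = mix s (mix (1/2) u v) b \<and> F (X n) = mix s (mix (1/2) (\<psi> u) (\<psi> v)) (\<psi> b) \<and>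
      (X n \<notin> Y \<longrightarrow> cen (X n) = (u, v))" using X(1) by blast
  then obtain U V B S where k: "\<And>n. U n \<in> Y" "\<And>n. V n \<in> Y" "\<And>n. B n \<in> Y" "\<And>n. unsep (U n) (V n)"
      "\<And>n. unsep (mix (1/2) (U n) (V n)) (B n)" "\<And>n. 0 \<le> S n" "\<And>n. S n \<le> 1"
      "\<And>n. X n = mix (S n) (mix (1/2) (U n) (V n)) (B n)"
      "\<And>n. F (X n) = mix (S n) (mix (1/2) (\<psi> (U n)) (\<psi> (V n))) (\<psi> (B n))"
      "\<And>n. X n \<notin> Y \<Longrightarrow> cen (X n) = (U n, V n)"
    by metis
  have "compact (Y \<times> Y \<times> Y \<times> {0..1::real})" by (intro compact_Times compact_Y) simp
  moreover have "\<forall>n. (U n, V n, B n, S n) \<in> Y \<times> Y \<times> Y \<times> {0..1}" using k by auto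
  ultimately obtain l r where l: "l \<in> Y \<times> Y \<times> Y \<times> {0..1}" and r: "strict_mono r"
    "((\<lambda>n. (U n, V n, B n, S n)) \<circ> r) \<longlonglongrightarrow> l"
    unfolding compact_def by meson
  obtain u v b s where luv: "l = (u, v, b, s)" by (cases l) auto
  have uv: "u \<in> Y" "v \<in> Y" "b \<in> Y" "0 \<le> s" "s \<le> 1" using l luv by auto
  have lim: "(\<lambda>n. U (r n)) \<longlonglongrightarrow> u" "(\<lambda>n. V (r n)) \<longlonglongrightarrow> v" "(\<lambda>n. B (r n)) \<longlonglongrightarrow> b" "(\<lambda>n. S (r n)) \<longlonglongrightarrow> s"
    using tendsto_fst[OF r(2)] tendsto_fst[OF tendsto_snd[OF r(2)]]
      tendsto_fst[OF tendsto_snd[OF tendsto_snd[OF r(2)]]] tendsto_snd[OF tendsto_snd[OF tendsto_snd[OF r(2)]]]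
    by (simp_all add: luv o_def)
  have un: "unsep u v" using unsep_limit[OF lim(1,2)] k(4) by blast
  have "(\<lambda>n. mix (1/2) (U (r n)) (V (r n))) \<longlonglongrightarrow> mix (1/2) u v" by (intro tendsto_mix lim tendsto_const)
  then have unb: "unsep (mix (1/2) u v) b" using unsep_limit[OF _ lim(3)] k(5) by blast
  have Xr: "(\<lambda>n. X (r n)) \<longlonglongrightarrow> z" "(\<lambda>n. F (X (r n))) \<longlonglongrightarrow> w"
    using LIMSEQ_subseq_LIMSEQ[OF X(2) r(1)] LIMSEQ_subseq_LIMSEQ[OF X(4) r(1)] by (simp_all add: o_def)
  have "(\<lambda>n. mix (S (r n)) (mix (1/2) (U (r n)) (V (r n))) (B (r n))) \<longlonglongrightarrow> mix s (mix (1/2) u v) b"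
    by (intro tendsto_mix lim tendsto_const)
  then have z: "z = mix s (mix (1/2) u v) b" using LIMSEQ_unique Xr(1) unfolding k(8)[symmetric] by blast
  have \<psi>l: "(\<lambda>n. \<psi> (U (r n))) \<longlonglongrightarrow> \<psi> u" "(\<lambda>n. \<psi> (V (r n))) \<longlonglongrightarrow> \<psi> v" "(\<lambda>n. \<psi> (B (r n))) \<longlonglongrightarrow> \<psi> b"
    using continuous_on_tendsto_compose[OF \<psi>_continuous lim(1) uv(1)]
      continuous_on_tendsto_compose[OF \<psi>_continuous lim(2) uv(2)]
      continuous_on_tendsto_compose[OF \<psi>_continuous lim(3) uv(3)] k(1,2,3) by simp_all
  have "(\<lambda>n. mix (S (r n)) (mix (1/2) (\<psi> (U (r n))) (\<psi> (V (r n)))) (\<psi> (B (r n))))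
      \<longlonglongrightarrow> mix s (mix (1/2) (\<psi> u) (\<psi> v)) (\<psi> b)"
    by (intro tendsto_mix lim \<psi>l tendsto_const)
  then have w: "w = mix s (mix (1/2) (\<psi> u) (\<psi> v)) (\<psi> b)"
    using LIMSEQ_unique Xr(2) unfolding k(9)[symmetric] by blast
  show "F z = w"
  proof (cases "z \<in> Y")
    case True
    then show ?thesis using \<psi>_mix3[OF uv(1,2,3) un unb uv(4,5)] F_Y z w by simp
  next
    case False
    then have g: "z \<in> disc - Y" using X(3) by blast
    obtain e where e: "e > 0" "ball z e \<subseteq> disc - Y" using open_gaps(2) g openE by blast
    \<comment> \<open>No leaf meets this ball, so its points are on the same sides of all leaves as
      \<open>z\<close>. Hence the selected pair is eventually constant and its limit is
      \<open>cen z\<close>.\<close>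
    have const: "cen x = cen z \<and> x \<notin> Y" if "x \<in> ball z e" for x
    proof -
      have "closed_segment z x \<subseteq> ball z e" using that e(1) by (simp add: closed_segment_subset)
      then have "open_segment z x \<inter> Y = {}" using e(2) open_closed_segment by blast
      then have "unsep z x" using unsep_avoid_Y g that e(2) by blast
      then have "same_sides z x" using unsep_same_sides g that e(2) by blast
      then have "cen x = cen z" using cen_cong by metis
      then show ?thesis using that e(2) by blast
    qed
    have "\<forall>\<^sub>F n in sequentially. X (r n) \<in> ball z e"
      using Xr(1) e(1) by (simp add: tendsto_iff dist_commute)
    then have ev: "\<forall>\<^sub>F n in sequentially. (U (r n), V (r n)) = cen z"
      by (rule eventually_mono) (use const k(10) in metis)
    have "\<forall>\<^sub>F n in sequentially. U (r n) = fst (cen z)" "\<forall>\<^sub>F n in sequentially. V (r n) = snd (cen z)"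
      using ev by (auto elim!: eventually_mono dest: sym)
    then have "(\<lambda>n. U (r n)) \<longlonglongrightarrow> fst (cen z)" "(\<lambda>n. V (r n)) \<longlonglongrightarrow> snd (cen z)"
      by (simp_all add: tendsto_eventually)
    then have uvz: "u = fst (cen z)" "v = snd (cen z)" using lim(1,2) LIMSEQ_unique by blast+
    have c: "cone_point z = mix (1/2) u v" "image_cone_point z = mix (1/2) (\<psi> u) (\<psi> v)"
      by (simp_all add: cone_point_def image_cone_point_def uvz)
    have "crep (cone_point z) z b s"
      unfolding crep_def c using uv(3,4,5) unb z by blast
    then show ?thesis using F_crep[OF g] w unfolding c by blast
  qed
qed

section \<open>Surjectivity and images of leaves\<close>

lemma F_surj: "F ` disc = disc"
proof (rule ccontr)
  assume "F ` disc \<noteq> disc"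
  then obtain w where w: "w \<in> disc" "w \<notin> F ` disc" using F_disc by blast
  have "w \<notin> circle"
  proof
    assume "w \<in> circle"
    then obtain z where "z \<in> circle" "w = f z" using f_image by blast
    then have "w = F z" "z \<in> disc" using F_circle by auto
    then show False using w(2) by blast
  qed
  then have w1: "w \<in> ball 0 1" using w(1) disc_cases by auto
  obtain g where g: "homeomorphism circle circle f g"
    using homeomorphism_compact[OF compact_sphere continuous_f f_image inj_f] by blast
  have "rel_frontier disc retract_of (affine hull disc - {w})"
  proof (rule rel_frontier_retract_of_punctured_affine_hull)
    show "w \<in> rel_interior disc" using w1 by (simp add: rel_interior_nonempty_interior)
  qed simp_all
  moreover have "affine hull disc = (UNIV :: complex set)"
    using affine_hull_nonempty_interior[of "disc"] by simp
  moreover have "rel_frontier disc = circle" by (simp add: rel_frontier_cball)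
  ultimately obtain \<rho> where \<rho>: "retraction (UNIV - {w}) circle \<rho>" unfolding retract_of_def by auto
  have rho: "continuous_on (UNIV - {w}) \<rho>" "\<And>x. x \<noteq> w \<Longrightarrow> \<rho> x \<in> circle" "\<And>x. x \<in> circle \<Longrightarrow> \<rho> x = x"
    using \<rho> unfolding retraction_def by auto
  have Fw: "F ` disc \<subseteq> UNIV - {w}" using w(2) by blast
  \<comment> \<open>On the circle \<open>F\<close> is \<open>f\<close>, so the inverse
    \<open>g\<close> makes the composite the identity there.\<close>
  have "retraction disc circle (g \<circ> (\<rho> \<circ> F))"
    unfolding retraction_def
  proof (intro conjI)
    have "continuous_on disc (\<rho> \<circ> F)"
      by (rule continuous_on_compose[OF F_continuous]) (rule continuous_on_subset[OF rho(1) Fw])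
    moreover have im: "(\<rho> \<circ> F) ` disc \<subseteq> circle" using rho(2) w(2) by force
    ultimately show "continuous_on disc (g \<circ> (\<rho> \<circ> F))"
      using continuous_on_compose continuous_on_subset homeomorphism_cont2[OF g] by blast
    have "g ` circle = circle" using g by (simp add: homeomorphism_def)
    then show "g \<circ> (\<rho> \<circ> F) \<in> disc \<rightarrow> circle" using im by fastforce
    show "\<forall>x\<in>circle. (g \<circ> (\<rho> \<circ> F)) x = x"
      using F_circle rho(3) f_circle homeomorphism_apply1[OF g] by simp
  qed auto
  then show False using no_retraction_cball[of 1 "0::complex"] unfolding retract_of_def by auto
qed

lemma F_homeomorphism: "\<exists>G. homeomorphism disc disc F G"
  by (rule homeomorphism_compact[OF compact_cball F_continuous F_surj F_inj])

text \<open>One inclusion is \<open>compat_leaf\<close>. For the other, surjectivity supplies a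
  preimage, and \<open>compat\<close> gives it side zero because \<sigma> does not vanish.\<close>

lemma F_leaf:
  assumes ab: "(a, b) \<in> \<Gamma> i"
  shows "F ` closed_segment a b = closed_segment (f a) (f b)"
proof (cases "a = b")
  case True then show ?thesis using F_circle leaf_circle[OF ab] by simp
next
  case False
  have c: "a \<in> circle" "b \<in> circle" using leaf_circle[OF ab] by auto
  show ?thesis
  proof (intro equalityI subsetI)
    fix w assume "w \<in> F ` closed_segment a b"
    then obtain z where z: "z \<in> closed_segment a b" "w = F z" by blast
    have "z \<in> disc" using leaf_disc[OF ab z(1)] .
    then show "w \<in> closed_segment (f a) (f b)"
      unfolding z(2) by (intro compat_leaf[OF ab z(1)] F_compat F_disc F_circle)
  next
    fix w assume w: "w \<in> closed_segment (f a) (f b)"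
    have "w \<in> disc" using w segment_in_disc[of "f a" "f b"] f_circle c by (metis sphere_cball subsetD)
    then obtain z where z: "z \<in> disc" "w = F z" using F_surj by blast
    have "side a b z = 0"
      using F_compat[OF z(1)] ab segment_side_0[OF w] \<sigma>_nonzero unfolding z(2) compat_def
      by (metis mult_eq_0_iff sgn_0_0)
    then show "w \<in> F ` closed_segment a b" using side_0_segment[OF c False z(1)] z(2) by blast
  qed
qed

end

section \<open>Arcs and transverse prelaminations\<close>

lemma circle_polar:
  assumes "a \<in> circle" "z \<in> circle" "z \<noteq> a"
  obtains s where "0 < s" "s < 2 * pi" "z = a * cis s"
proof -
  have a: "a \<noteq> 0" using assms(1) by auto
  define s where "s = Arg2pi (z / a)"
  have "norm (z / a) = 1" using assms by (simp add: norm_divide)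
  then have "z / a = cis s" using Arg2pi[of "z / a"] by (simp add: s_def cis_conv_exp is_Arg_def)
  then have z: "z = a * cis s" using a by (simp add: field_simps)
  moreover have "s \<noteq> 0" using z assms(3) by auto
  then have "0 < s" "s < 2 * pi" using Arg2pi[of "z / a"] unfolding s_def by linarith+
  ultimately show thesis using that by blast
qed

text \<open>For angles strictly between 0 and \<open>2 * pi\<close> the first two sines are
  positive, so the order of the angles decides the side.\<close>

lemma side_polar:
  assumes "a \<in> circle"
  shows "side a (a * cis q) (a * cis s) = 4 * sin (q / 2) * sin (s / 2) * sin ((s - q) / 2)"
proof -
  define P Q where "P = (s - q) / 2" and "Q = q / 2"
  then have PQ: "s = 2 * P + 2 * Q" "q = 2 * Q" by (simp_all add: diff_divide_distrib)
  have "cnj a * a = 1" using assms complex_norm_square[of a] by (simp add: mult.commute)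
  moreover have "cnj (a * cis q - a) * (a * cis s - a) = (cnj a * a) * (cnj (cis q - 1) * (cis s - 1))"
    by (simp add: algebra_simps)
  ultimately have "side a (a * cis q) (a * cis s) = Im (cnj (cis q - 1) * (cis s - 1))"
    by (simp add: side_def)
  also have "\<dots> = sin (s - q) + sin q - sin s"
    by (simp add: algebra_simps sin_diff)
  also have "\<dots> = sin (2 * P) + sin (2 * Q) - sin (2 * P + 2 * Q)"
    by (simp add: PQ)
  also have "\<dots> = 4 * sin Q * sin (P + Q) * sin P"
    unfolding sin_add cos_double_sin sin_double by (simp add: algebra_simps power2_eq_square)
  also have "\<dots> = 4 * sin (q / 2) * sin (s / 2) * sin ((s - q) / 2)"
    by (simp add: PQ add_divide_distrib)
  finally show ?thesis .
qed

lemma sgn_side_polar: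
  assumes "a \<in> circle" "0 < q" "q < 2 * pi" "0 < s" "s < 2 * pi"
  shows "sgn (side a (a * cis q) (a * cis s)) = sgn (s - q)"
proof -
  have "sin (q / 2) > 0" "sin (s / 2) > 0" using assms by (auto intro!: sin_gt_zero)
  moreover have "sgn (sin ((s - q) / 2)) = sgn (s - q)"
  proof (cases s q rule: linorder_cases)
    case less
    then have "sin ((q - s) / 2) > 0" using assms by (intro sin_gt_zero) auto
    moreover have "sin ((s - q) / 2) = - sin ((q - s) / 2)" by (metis minus_diff_eq minus_divide_left sin_minus)
    ultimately show ?thesis using less by simp
  next
    case greater
    then have "sin ((s - q) / 2) > 0" using assms by (intro sin_gt_zero) auto
    then show ?thesis using greater by simp
  qed simp
  ultimately show ?thesis using side_polar[OF assms(1)] by (simp add: sgn_mult)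
qed

lemma arc_point:
  assumes "a \<in> circle" "b \<in> circle" "a \<noteq> b"
  obtains x where "x \<in> circle" "side a b x > 0"
proof -
  obtain q where q: "0 < q" "q < 2 * pi" "b = a * cis q" using circle_polar assms by metis
  \<comment> \<open>Halfway along the arc from \<open>b\<close> on to \<open>a\<close>, where the
    angle exceeds \<open>q\<close>.\<close>
  define s where "s = (q + 2 * pi) / 2"
  have "sgn (side a b (a * cis s)) = sgn (s - q)"
    unfolding q(3) by (rule sgn_side_polar) (use q assms in \<open>auto simp: s_def\<close>)
  also have "\<dots> = 1" using q by (simp add: s_def)
  finally have "side a b (a * cis s) > 0" by (simp add: sgn_1_pos)
  moreover have "a * cis s \<in> circle" using assms by (simp add: norm_mult)
  ultimately show thesis using that by blast
qed

text \<open>Forwards, \<open>side a b\<close> has no zero on the punctured circle and keeps its sign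
  on connected sets. Backwards, equal signs put both angles on the same side of \<open>q\<close>,
  and an interval of angles joins the points.\<close>

lemma same_arc_iff:
  assumes ab: "a \<in> circle" "b \<in> circle" "a \<noteq> b" and xy: "x \<in> circle - {a, b}" "y \<in> circle - {a, b}"
  shows "connected_component (circle - {a, b}) x y \<longleftrightarrow> side a b x * side a b y > 0"
proof
  assume "connected_component (circle - {a, b}) x y"
  then obtain T where T: "connected T" "T \<subseteq> circle - {a, b}" "x \<in> T" "y \<in> T"
    unfolding connected_component_def by blast
  have "connected (side a b ` T)"
    by (rule connected_continuous_image[OF _ T(1)]) (intro continuous_intros)
  then have int: "\<And>u v w. u \<in> side a b ` T \<Longrightarrow> v \<in> side a b ` T \<Longrightarrow> u \<le> w \<Longrightarrow> w \<le> v \<Longrightarrow> w \<in> side a b ` T"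
    unfolding connected_iff_interval by blast
  have "0 \<notin> side a b ` T" using T(2) side_0_circle[OF ab] by force
  then have "\<not> (side a b x \<le> 0 \<and> 0 \<le> side a b y)" "\<not> (side a b y \<le> 0 \<and> 0 \<le> side a b x)"
    using int T(3,4) by blast+
  then show "side a b x * side a b y > 0" by (auto simp: zero_less_mult_iff)
next
  assume pos: "side a b x * side a b y > 0"
  obtain q where q: "0 < q" "q < 2 * pi" "b = a * cis q" using circle_polar ab by metis
  obtain s where s: "0 < s" "s < 2 * pi" "x = a * cis s" using circle_polar[OF ab(1)] xy by blast
  obtain t where t: "0 < t" "t < 2 * pi" "y = a * cis t" using circle_polar[OF ab(1)] xy by blast
  have sg: "sgn (side a b (a * cis r)) = sgn (r - q)" if "0 < r" "r < 2 * pi" for r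
    unfolding q(3) using sgn_side_polar[OF ab(1) q(1,2) that] .
  have arc: "connected_component (circle - {a, b}) x y"
    if I: "connected I" "I \<subseteq> {0<..<2 * pi} - {q}" "s \<in> I" "t \<in> I" for I
    unfolding connected_component_def
  proof (intro exI[of _ "(\<lambda>r. a * cis r) ` I"] conjI)
    show "connected ((\<lambda>r. a * cis r) ` I)"
      by (rule connected_continuous_image[OF _ I(1)]) (intro continuous_intros)
    show "(\<lambda>r. a * cis r) ` I \<subseteq> circle - {a, b}"
    proof
      fix z assume "z \<in> (\<lambda>r. a * cis r) ` I"
      then obtain r where r: "r \<in> I" "z = a * cis r" by blast
      then have "0 < r" "r < 2 * pi" "r \<noteq> q" using I(2) by auto
      then have "side a b z \<noteq> 0" using sg[of r] r(2) by (auto simp: sgn_if split: if_splits)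
      then have "z \<noteq> a" "z \<noteq> b" by auto
      then show "z \<in> circle - {a, b}" using r(2) ab(1) by (simp add: norm_mult)
    qed
  qed (use I s t in auto)
  have "sgn (s - q) * sgn (t - q) = sgn (side a b x * side a b y)"
    unfolding sgn_mult using sg s t by simp
  then have "sgn (s - q) * sgn (t - q) = 1" using pos by simp
  then consider "s < q" "t < q" | "s > q" "t > q"
    by (cases s q rule: linorder_cases; cases t q rule: linorder_cases) auto
  then show "connected_component (circle - {a, b}) x y"
  proof cases
    case 1
    have "{0<..<q} \<subseteq> {0<..<2 * pi} - {q}" using q(2) by (intro subsetI) simp
    from arc[OF _ this] show ?thesis using 1 s(1) t(1) by simp
  next
    case 2
    have "{q<..<2 * pi} \<subseteq> {0<..<2 * pi} - {q}" using q(1) by (intro subsetI) simp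
    from arc[OF _ this] show ?thesis using 2 s(2) t(2) by simp
  qed
qed

lemma crosses_iff_side:
  assumes "a \<in> circle" "b \<in> circle" "a \<noteq> b" "c \<in> circle" "d \<in> circle" "c \<noteq> d"
  shows "crosses {a, b} {c, d} \<longleftrightarrow> side c d a * side c d b < 0"
proof
  assume "crosses {a, b} {c, d}"
  then obtain u v where uv: "{a, b} = {u, v}" "u \<in> circle - {c, d}" "v \<in> circle - {c, d}"
    "\<not> connected_component (circle - {c, d}) u v" unfolding crosses_def by blast
  have "\<not> side c d u * side c d v > 0" using same_arc_iff[OF assms(4,5,6) uv(2,3)] uv(4) by blast
  moreover have "side c d u \<noteq> 0" "side c d v \<noteq> 0" using side_0_circle[OF assms(4,5,6)] uv(2,3) by auto
  ultimately have "side c d u * side c d v < 0" by (simp add: linorder_not_less order.order_iff_strict)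
  then show "side c d a * side c d b < 0" using uv(1) by (metis doubleton_eq_iff mult.commute)
next
  assume neg: "side c d a * side c d b < 0"
  have "a \<noteq> c" "a \<noteq> d" "b \<noteq> c" "b \<noteq> d" using neg by auto
  then have ab: "a \<in> circle - {c, d}" "b \<in> circle - {c, d}" using assms by auto
  then have "\<not> connected_component (circle - {c, d}) a b" using same_arc_iff[OF assms(4,5,6)] neg by simp
  moreover have "is_pair {a, b}" "is_pair {c, d}" using assms unfolding is_pair_def by blast+
  ultimately show "crosses {a, b} {c, d}" unfolding crosses_def using ab by blast
qed

lemma same_arc_image:
  assumes f: "homeomorphism circle circle f g" and ab: "a \<in> circle" "b \<in> circle"
    and con: "connected_component (circle - {a, b}) x y"
  shows "connected_component (circle - {f a, f b}) (f x) (f y)"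
proof -
  obtain T where T: "connected T" "T \<subseteq> circle - {a, b}" "x \<in> T" "y \<in> T"
    using con unfolding connected_component_def by blast
  have "connected (f ` T)"
    by (rule connected_continuous_image[OF _ T(1)])
      (use T(2) homeomorphism_cont1[OF f] continuous_on_subset in blast)
  moreover have "f ` T \<subseteq> circle - {f a, f b}"
  proof
    fix w assume "w \<in> f ` T"
    then obtain t where t: "t \<in> T" "w = f t" by blast
    then have "t \<in> circle" "t \<noteq> a" "t \<noteq> b" using T(2) by auto
    then have "f t \<in> circle" "f t \<noteq> f a" "f t \<noteq> f b"
      using homeomorphism_image1[OF f] homeomorphism_apply1[OF f] ab by (blast, metis+)
    then show "w \<in> circle - {f a, f b}" using t(2) by simp
  qed
  ultimately show ?thesis unfolding connected_component_def using T(3,4) by blast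
qed

text \<open>Since \<open>f\<close> carries arcs to arcs, the image sign is constant on each of the
  two open arcs and differs between them; one sample point fixes the factor.\<close>

lemma side_homeomorphism:
  assumes f: "homeomorphism circle circle f g" and ab: "a \<in> circle" "b \<in> circle"
  shows "\<exists>s. s \<noteq> 0 \<and> (\<forall>x\<in>circle. sgn (side (f a) (f b) (f x)) = s * sgn (side a b x))"
proof (cases "a = b")
  case True then show ?thesis by (intro exI[of _ 1]) simp
next
  case False
  have fc: "f x \<in> circle" "g (f x) = x" if "x \<in> circle" for x
    using that homeomorphism_image1[OF f] homeomorphism_apply1[OF f] by blast+
  have fab: "f a \<noteq> f b" using False fc ab by metis
  have iff: "side a b x * side a b y > 0 \<longleftrightarrow> side (f a) (f b) (f x) * side (f a) (f b) (f y) > 0"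
    if xy: "x \<in> circle - {a, b}" "y \<in> circle - {a, b}" for x y
  proof -
    have "f x \<noteq> f a" "f x \<noteq> f b" "f y \<noteq> f a" "f y \<noteq> f b" using xy ab fc by (metis DiffE insertCI)+
    then have fxy: "f x \<in> circle - {f a, f b}" "f y \<in> circle - {f a, f b}" using fc xy by auto
    have "connected_component (circle - {a, b}) x y \<longleftrightarrow> connected_component (circle - {f a, f b}) (f x) (f y)"
      using same_arc_image[OF f ab] same_arc_image[OF homeomorphism_symD[OF f] fc(1)[OF ab(1)] fc(1)[OF ab(2)], of "f x" "f y"]
        fc(2) ab xy by auto
    then show ?thesis
      using same_arc_iff[OF ab False xy] same_arc_iff[OF fc(1)[OF ab(1)] fc(1)[OF ab(2)] fab fxy] by blast
  qed
  have nz: "side a b x \<noteq> 0" "side (f a) (f b) (f x) \<noteq> 0" if "x \<in> circle - {a, b}" for x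
  proof -
    show "side a b x \<noteq> 0" using side_0_circle[OF ab False] that by blast
    have "f x \<noteq> f a" "f x \<noteq> f b" using that ab fc by (metis DiffE insertCI)+
    then show "side (f a) (f b) (f x) \<noteq> 0"
      using side_0_circle[OF fc(1)[OF ab(1)] fc(1)[OF ab(2)] fab] that fc(1) by blast
  qed
  obtain x0 where "x0 \<in> circle" "side a b x0 > 0" using arc_point[OF ab False] by blast
  then have x0: "x0 \<in> circle - {a, b}" "side a b x0 > 0" by auto
  let ?s = "sgn (side (f a) (f b) (f x0))"
  have "sgn (side (f a) (f b) (f x)) = ?s * sgn (side a b x)" if "x \<in> circle" for x
  proof (cases "x = a \<or> x = b")
    case True then show ?thesis by auto
  next
    case False
    then have x: "x \<in> circle - {a, b}" using that by simp
    show ?thesis using iff[OF x x0(1)] nz[OF x] nz[OF x0(1)] x0(2)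
      by (auto simp: sgn_if zero_less_mult_iff)
  qed
  moreover have "?s \<noteq> 0" using nz(2)[OF x0(1)] by (simp add: sgn_zero_iff)
  ultimately show ?thesis by blast
qed

section \<open>Closures of prelaminations\<close>

definition leaf_pairs :: "complex set set \<Rightarrow> (complex \<times> complex) set" where
  "leaf_pairs L = {(a, b). {a, b} \<in> L}"

lemma prelamination_leaf:
  assumes "prelamination L" "{a, b} \<in> L"
  shows "a \<in> circle" "b \<in> circle" "a \<noteq> b"
proof -
  have "is_pair {a, b}" using assms unfolding prelamination_def by blast
  then obtain c d where "c \<in> circle" "d \<in> circle" "c \<noteq> d" "{a, b} = {c, d}" unfolding is_pair_def by blast
  then show "a \<in> circle" "b \<in> circle" "a \<noteq> b" by (auto simp: doubleton_eq_iff)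
qed

lemma prelamination_side:
  assumes "prelamination L" "{a, b} \<in> L" "{c, d} \<in> L"
  shows "side a b c * side a b d \<ge> 0"
proof -
  have "\<not> crosses {c, d} {a, b}" using assms unfolding prelamination_def by blast
  then show ?thesis using crosses_iff_side prelamination_leaf assms by (metis linorder_not_less)
qed

lemma leaf_in_closure: "{a, b} \<in> L \<Longrightarrow> (a, b) \<in> closure (leaf_pairs L)"
  by (rule subsetD[OF closure_subset]) (simp add: leaf_pairs_def)

lemma closure_leaf_circle:
  assumes "prelamination L" "(a, b) \<in> closure (leaf_pairs L)"
  shows "a \<in> circle \<and> b \<in> circle"
proof -
  have "closure (leaf_pairs L) \<subseteq> circle \<times> circle"
    using prelamination_leaf[OF assms(1)]
    by (intro closure_minimal closed_Times) (auto simp: leaf_pairs_def)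
  then show ?thesis using assms(2) by blast
qed

text \<open>The inequality is closed in each pair separately, so limits are taken in one pair at a
  time.\<close>

lemma closure_leaf_side:
  assumes "prelamination L" "(a, b) \<in> closure (leaf_pairs L)" "(c, d) \<in> closure (leaf_pairs L)"
  shows "side a b c * side a b d \<ge> 0"
proof -
  have *: "side p q r * side p q s \<ge> 0" if "(p, q) \<in> closure (leaf_pairs L)" "{r, s} \<in> L" for p q r s
  proof -
    have "closure (leaf_pairs L) \<subseteq> {x. 0 \<le> side (fst x) (snd x) r * side (fst x) (snd x) s}"
      using prelamination_side[OF assms(1) _ that(2)]
      by (intro closure_minimal closed_Collect_le continuous_intros) (auto simp: leaf_pairs_def)
    then show ?thesis using that(1) by auto
  qed
  have "closure (leaf_pairs L) \<subseteq> {x. 0 \<le> side a b (fst x) * side a b (snd x)}"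
    using *[OF assms(2)]
    by (intro closure_minimal closed_Collect_le continuous_intros) (auto simp: leaf_pairs_def)
  then show ?thesis using assms(3) by auto
qed

text \<open>The closure is taken among ordered pairs; symmetry lets limits be compared as unordered
  ones.\<close>

lemma closure_leaf_swap:
  assumes "(a, b) \<in> closure (leaf_pairs L)"
  shows "(b, a) \<in> closure (leaf_pairs L)"
proof -
  have "prod.swap ` closure (leaf_pairs L) \<subseteq> closure (prod.swap ` leaf_pairs L)"
    by (rule image_closure_subset[OF continuous_on_swap closed_closure closure_subset])
  also have "prod.swap ` leaf_pairs L = leaf_pairs L" by (auto simp: leaf_pairs_def insert_commute image_iff)
  finally show ?thesis using assms by force
qed

text \<open>A chord that no leaf of either lamination crosses would split the leaves into two families
  between which there are no crossings, and by density of endpoints both families are nonempty.\<close>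
lemma transverse_no_common_limit:
  assumes Lp: "prelamination Lp" and Lm: "prelamination Lm" and ft: "fully_transverse Lp Lm"
    and p: "(a, b) \<in> closure (leaf_pairs Lp)" and m: "(a, b) \<in> closure (leaf_pairs Lm)"
  shows "a = b"
proof (rule ccontr)
  assume ne: "a \<noteq> b"
  let ?L = "Lp \<union> Lm"
  have ab: "a \<in> circle" "b \<in> circle" using closure_leaf_circle[OF Lp p] by auto
  have uncrossed: "side a b c * side a b d \<ge> 0" if "{c, d} \<in> ?L" for c d
  proof -
    have "{c, d} \<in> Lp \<or> {c, d} \<in> Lm" using that by blast
    then show ?thesis
      using closure_leaf_side[OF Lp p leaf_in_closure] closure_leaf_side[OF Lm m leaf_in_closure] by auto
  qed
  have leaf: "c \<in> circle \<and> d \<in> circle \<and> c \<noteq> d" if "{c, d} \<in> ?L" for c d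
    using that prelamination_leaf Lp Lm by blast
  have pair: "\<exists>d. \<alpha> = {c, d}" if "\<alpha> \<in> ?L" "c \<in> \<alpha>" for \<alpha> c
  proof -
    have "is_pair \<alpha>" using that Lp Lm unfolding prelamination_def by blast
    then show ?thesis using that(2) unfolding is_pair_def by blast
  qed
  \<comment> \<open>By \<open>uncrossed\<close>, a leaf with one end strictly on the positive side
    has no end strictly on the negative side.\<close>
  define pos where "pos \<alpha> \<longleftrightarrow> (\<exists>c\<in>\<alpha>. side a b c > 0)" for \<alpha>
  \<comment> \<open>The crossing point lies on both leaves; if only the first had a positive end,
    \<open>side a b\<close> would be positive and nonpositive there.\<close>
  have step: "pos \<beta>" if st: "pos \<alpha>" "\<alpha> \<in> ?L" "\<beta> \<in> ?L" "crosses \<alpha> \<beta>" for \<alpha> \<beta>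
  proof (rule ccontr)
    assume "\<not> pos \<beta>"
    obtain c d where cd: "\<alpha> = {c, d}" "side a b c > 0" using st(1,2) pair unfolding pos_def by blast
    have "\<beta> \<noteq> {}" using st(4) unfolding crosses_def is_pair_def by blast
    then obtain e g where eg: "\<beta> = {e, g}" using pair st(3) by blast
    have c: "c \<in> circle" "d \<in> circle" "c \<noteq> d" using leaf st(2) cd(1) by blast+
    have e: "e \<in> circle" "g \<in> circle" "e \<noteq> g" using leaf st(3) eg by blast+
    have "side e g c * side e g d < 0" using st(4) crosses_iff_side[OF c e] cd(1) eg by simp
    then obtain t where t: "0 < t" "t < 1" "side e g (mix t c d) = 0"
      using zero_between[of "side e g c" "side e g d"] by (metis side_mix)
    have "mix t c d \<in> disc" using mix_in_disc c t by simp
    then obtain s where s: "0 \<le> s" "s \<le> 1" "mix t c d = mix s e g"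
      using side_0_segment[OF e _ t(3)] closed_segment_mix by metis
    have "side a b d \<ge> 0" using uncrossed[of c d] st(2) cd by (simp add: zero_le_mult_iff)
    then have "side a b (mix t c d) > 0" unfolding side_mix using t cd(2) by (simp add: add_pos_nonneg)
    moreover have "side a b e \<le> 0" "side a b g \<le> 0" using \<open>\<not> pos \<beta>\<close> eg unfolding pos_def by auto
    then have "side a b (mix s e g) \<le> 0"
      unfolding side_mix using s(1,2) by (intro add_nonpos_nonpos mult_nonneg_nonpos) auto
    ultimately show False using s(3) by simp
  qed
  have chain: "pos \<beta>" if "pos \<alpha>" "(\<lambda>x y. x \<in> ?L \<and> y \<in> ?L \<and> crosses x y)\<^sup>*\<^sup>* \<alpha> \<beta>" for \<alpha> \<beta>
    using that(2,1) by (induction rule: rtranclp_induct) (use step in blast)+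
  have meets: "\<exists>\<alpha>\<in>?L. \<exists>c\<in>\<alpha>. side u v c > 0" if uv: "u \<in> circle" "v \<in> circle" "u \<noteq> v" for u v
  proof -
    obtain x where x: "x \<in> circle" "side u v x > 0" using arc_point[OF uv] by blast
    have "open {z. 0 < side u v z}" by (intro open_Collect_less continuous_intros)
    moreover have "x \<in> closure (\<Union> ?L)" using ft x(1) unfolding fully_transverse_def by blast
    ultimately have "{z. 0 < side u v z} \<inter> \<Union> ?L \<noteq> {}"
      using x(2) open_Int_closure_eq_empty by blast
    then show ?thesis by blast
  qed
  obtain \<alpha> where \<alpha>: "\<alpha> \<in> ?L" "pos \<alpha>" using meets[OF ab ne] unfolding pos_def by blast
  \<comment> \<open>Swapping \<open>a\<close> and \<open>b\<close> makes the opposite arc the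
    positive one.\<close>
  obtain \<beta> e where \<beta>: "\<beta> \<in> ?L" "e \<in> \<beta>" "side a b e < 0"
    using meets[OF ab(2,1)] ne side_swap by (metis neg_0_less_iff_less)
  have "pos \<beta>" using chain[OF \<alpha>(2)] ft \<alpha>(1) \<beta>(1) unfolding fully_transverse_def by blast
  then obtain c where c: "c \<in> \<beta>" "side a b c > 0" unfolding pos_def by blast
  obtain d where "\<beta> = {e, d}" using pair \<beta> by blast
  then have "\<beta> = {e, c}" using c \<beta> by auto
  then show False using uncrossed[of e c] \<beta> c by (simp add: zero_le_mult_iff)
qed

theorem theoremA1:
  fixes Lp Lm :: "complex set set" and f :: "complex \<Rightarrow> complex"
  assumes "prelamination Lp" and "prelamination Lm"
    and "fully_transverse Lp Lm"
    and "\<exists>g. homeomorphism circle circle f g"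
  shows "\<exists>F G. homeomorphism disc disc F G \<and> (\<forall>z\<in>circle. F z = f z) \<and>
           (\<forall>\<gamma>\<in>Geo Lp. F ` \<gamma> \<in> Geo (image_lam f Lp)) \<and>
           (\<forall>\<gamma>\<in>Geo Lm. F ` \<gamma> \<in> Geo (image_lam f Lm))"
proof -
  obtain g where g: "homeomorphism circle circle f g" using assms(4) by blast
  define L where "L i = (if i then Lp else Lm)" for i
  have L: "prelamination (L i)" for i using assms(1,2) by (simp add: L_def)
  \<comment> \<open>The diagonal supplies the degenerate leaf at every point of the circle, and its
    compactness keeps the union closed.\<close>
  define \<Gamma> where "\<Gamma> i = closure (leaf_pairs (L i)) \<union> (\<lambda>a. (a, a)) ` circle" for i
  have common: "a = b" if "(a, b) \<in> closure (leaf_pairs (L i))" "(a, b) \<in> closure (leaf_pairs (L j))" "i \<noteq> j" for a b i j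
    using that transverse_no_common_limit[OF assms(1-3)] unfolding L_def by (auto split: if_splits)
  obtain \<sigma> where \<sigma>: "\<And>a b. a \<in> circle \<Longrightarrow> b \<in> circle \<Longrightarrow> \<sigma> a b \<noteq> (0::real) \<and>
      (\<forall>x\<in>circle. sgn (side (f a) (f b) (f x)) = \<sigma> a b * sgn (side a b x))"
    using side_homeomorphism[OF g] by metis
  \<comment> \<open>The value 1 off the circle is a default: the factor has to be nonzero for all
    arguments.\<close>
  interpret closed_bilamination \<Gamma> f "\<lambda>a b. if a \<in> circle \<and> b \<in> circle then \<sigma> a b else 1"
  proof
    show "closed (\<Gamma> i)" for i
      unfolding \<Gamma>_def
      by (intro closed_Un closed_closure compact_imp_closed compact_continuous_image continuous_intros compact_sphere)
    show c: "a \<in> circle \<and> b \<in> circle" if "(a, b) \<in> \<Gamma> i" for a b i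
      using that closure_leaf_circle[OF L] unfolding \<Gamma>_def by blast
    show "(a, a) \<in> \<Gamma> i" if "a \<in> circle" for a i using that unfolding \<Gamma>_def by blast
    show "0 \<le> side a b c * side a b d" if "(a, b) \<in> \<Gamma> i" "(c, d) \<in> \<Gamma> i" for a b c d i
      using that closure_leaf_side[OF L] unfolding \<Gamma>_def by auto
    show "{a, b} \<noteq> {c, d}" if "(a, b) \<in> \<Gamma> i" "(c, d) \<in> \<Gamma> j" "i \<noteq> j" "a \<noteq> b" for a b c d i j
    proof
      assume eq: "{a, b} = {c, d}"
      have "(a, b) \<in> closure (leaf_pairs (L i))" using that unfolding \<Gamma>_def by auto
      moreover have "(c, d) \<in> closure (leaf_pairs (L j))" using that eq unfolding \<Gamma>_def by auto
      then have "(a, b) \<in> closure (leaf_pairs (L j))" using eq closure_leaf_swap by (metis doubleton_eq_iff)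
      ultimately show False using common that(3,4) by blast
    qed
    show "continuous_on circle f" using homeomorphism_cont1[OF g] .
    show "inj_on f circle" using homeomorphism_apply1[OF g] by (rule inj_on_inverseI)
    show "f ` circle = circle" using homeomorphism_image1[OF g] .
  qed (use \<sigma> in auto)
  have leaf: "F ` closed_segment a b = closed_segment (f a) (f b)" if "{a, b} \<in> L i" for a b i
    by (rule F_leaf[of _ _ i]) (simp add: \<Gamma>_def leaf_in_closure that)
  have "F ` \<gamma> \<in> Geo (image_lam f (L i))" if "\<gamma> \<in> Geo (L i)" for \<gamma> i
  proof -
    obtain a b where "\<gamma> = closed_segment a b" "{a, b} \<in> L i" using \<open>\<gamma> \<in> Geo (L i)\<close> unfolding Geo_def by blast
    then show ?thesis using leaf unfolding Geo_def image_lam_def by blast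
  qed
  from this[of _ True] this[of _ False]
  have "\<forall>\<gamma>\<in>Geo Lp. F ` \<gamma> \<in> Geo (image_lam f Lp)" "\<forall>\<gamma>\<in>Geo Lm. F ` \<gamma> \<in> Geo (image_lam f Lm)"
    by (simp_all add: L_def)
  then show ?thesis using F_homeomorphism F_circle by blast
qed

end
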